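(* Let $\mathcal{C}$ be a congruence-modular equational class, let $M,N$ be members of $\mathcal{C}$ and let $h:M\to N$ be a morphism in $\mathcal{C}$. If $h$ is surjective, then $h$ is admissible and fulfills GU and LO. The converse is not true, not even when $\mathcal{C}$ is congruence-distributive and semi-degenerate: there exist a congruence-distributive semi-degenerate equational class and a morphism in it which is admissible and fulfills GU and LO, but is not surjective.
   Context: An equational class (variety) $\mathcal{C}$ of algebras of a fixed type is congruence-modular (respectively congruence-distributive) if the congruence lattice $\mathrm{Con}(M)$ is modular (respectively distributive) for every member $M$ of $\mathcal{C}$; it is semi-degenerate if no non-trivial algebra in $\mathcal{C}$ has a one-element subalgebra. All algebras are non-empty; a morphism in $\mathcal{C}$ is a homomorphism between members of $\mathcal{C}$. For an algebra $M$, $\Delta_M$ is the equality relation and $\nabla_M=M^2$. In a congruence-modular class, the commutator $[\alpha,\beta]_M$ of $\alpha,\beta\in\mathrm{Con}(M)$ is the (Freese--McKenzie) modular commutator, i.e. the smallest congruence $\delta$ of $M$ such that, for every term $t(\bar x,\bar y)$ and all tuples $\bar a,\bar b,\bar c,\bar d$ of elements of $M$ with $(a_i,b_i)\in\alpha$ for all $i$ and $(c_j,d_j)\in\beta$ for all $j$, $(t(\bar a,\bar c),t(\bar a,\bar d))\in\delta$ implies $(t(\bar b,\bar c),t(\bar b,\bar d))\in\delta$; in congruence-distributive classes it equals $\alpha\cap\beta$. A congruence $\phi\neq\nabla_M$ is prime if, for all $\alpha,\beta\in\mathrm{Con}(M)$, $[\alpha,\beta]_M\subseteq\phi$ implies $\alpha\subseteq\phi$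 or $\beta\subseteq\phi$; $\mathrm{Spec}(M)$ is the set of prime congruences of $M$. For a morphism $f:A\to B$ and $\psi\in\mathrm{Con}(B)$, $f^*(\psi)=\{(x,y)\in A^2 : (f(x),f(y))\in\psi\}\in\mathrm{Con}(A)$ and $\mathrm{Ker}(f)=f^*(\Delta_B)$. $f$ is admissible if $f^*(\psi)\in\mathrm{Spec}(A)$ for all $\psi\in\mathrm{Spec}(B)$. An admissible morphism $f:A\to B$ fulfills GU (Going Up) if for all $\phi,\psi\in\mathrm{Spec}(A)$ and $\phi_1\in\mathrm{Spec}(B)$ with $\phi\subseteq\psi$ and $f^*(\phi_1)=\phi$ there is $\psi_1\in\mathrm{Spec}(B)$ with $\phi_1\subseteq\psi_1$ and $f^*(\psi_1)=\psi$; it fulfills LO (Lying Over) if for every $\phi\in\mathrm{Spec}(A)$ with $\mathrm{Ker}(f)\subseteq\phi$ there is $\phi_1\in\mathrm{Spec}(B)$ with $f^*(\phi_1)=\phi$. *)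

theory Defs
  imports Main
begin

section \<open>Algebras, terms and equational classes\<close>

text \<open>A type (signature) is a partial map from symbols to arities; the operation symbols are the
  elements of its domain.\<close>

type_synonym 'f sig = "'f \<rightharpoonup> nat"

datatype ('f, 'v) trm = Var 'v | App 'f "('f, 'v) trm list"

fun wf_trm :: "'f sig \<Rightarrow> ('f, 'v) trm \<Rightarrow> bool" where
  "wf_trm F (Var x) \<longleftrightarrow> True"
| "wf_trm F (App f ts) \<longleftrightarrow> F f = Some (length ts) \<and> (\<forall>t\<in>set ts. wf_trm F t)"

text \<open>Only the values of \<^term>\<open>interp A f\<close> on lists of the right length over the carrier matter.\<close>

record ('f, 'a) alg =
  carr :: "'a set"
  interp :: "'f \<Rightarrow> 'a list \<Rightarrow> 'a"

definition closed_under :: "'f sig \<Rightarrow> ('f, 'a) alg \<Rightarrow> 'a set \<Rightarrow> bool" where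
  "closed_under F A S \<longleftrightarrow>
     (\<forall>f xs. F f = Some (length xs) \<longrightarrow> set xs \<subseteq> S \<longrightarrow> interp A f xs \<in> S)"

definition is_alg :: "'f sig \<Rightarrow> ('f, 'a) alg \<Rightarrow> bool" where
  "is_alg F A \<longleftrightarrow> carr A \<noteq> {} \<and> closed_under F A (carr A)"

definition subuniverse :: "'f sig \<Rightarrow> ('f, 'a) alg \<Rightarrow> 'a set \<Rightarrow> bool" where
  "subuniverse F A S \<longleftrightarrow> S \<noteq> {} \<and> S \<subseteq> carr A \<and> closed_under F A S"

definition nontrivial :: "('f, 'a) alg \<Rightarrow> bool" where
  "nontrivial A \<longleftrightarrow> (\<exists>x\<in>carr A. \<exists>y\<in>carr A. x \<noteq> y)"

definition morphism :: "'f sig \<Rightarrow> ('f, 'a) alg \<Rightarrow> ('f, 'b) alg \<Rightarrow> ('a \<Rightarrow> 'b) \<Rightarrow> bool" where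
  "morphism F A B h \<longleftrightarrow> h ` carr A \<subseteq> carr B \<and>
     (\<forall>f xs. F f = Some (length xs) \<longrightarrow> set xs \<subseteq> carr A \<longrightarrow>
        h (interp A f xs) = interp B f (map h xs))"

fun eval :: "('f, 'a) alg \<Rightarrow> ('v \<Rightarrow> 'a) \<Rightarrow> ('f, 'v) trm \<Rightarrow> 'a" where
  "eval A v (Var x) = v x"
| "eval A v (App f ts) = interp A f (map (eval A v) ts)"

type_synonym 'f identities = "(('f, nat) trm \<times> ('f, nat) trm) set"

definition is_identities :: "'f sig \<Rightarrow> 'f identities \<Rightarrow> bool" where
  "is_identities F E \<longleftrightarrow> (\<forall>(s, t)\<in>E. wf_trm F s \<and> wf_trm F t)"

text \<open>The equational class presented by \<open>F\<close> and \<open>E\<close>; it is polymorphic in the carrier type.\<close>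

definition models :: "'f sig \<Rightarrow> 'f identities \<Rightarrow> ('f, 'a) alg set" where
  "models F E = {A. is_alg F A \<and>
     (\<forall>(s, t)\<in>E. \<forall>v. range v \<subseteq> carr A \<longrightarrow> eval A v s = eval A v t)}"


section \<open>Congruences\<close>

definition Con :: "'f sig \<Rightarrow> ('f, 'a) alg \<Rightarrow> 'a rel set" where
  "Con F A = {\<theta>. equiv (carr A) \<theta> \<and>
     (\<forall>f xs ys. F f = Some (length xs) \<longrightarrow> list_all2 (\<lambda>x y. (x, y) \<in> \<theta>) xs ys \<longrightarrow>
        (interp A f xs, interp A f ys) \<in> \<theta>)}"

definition nabla :: "('f, 'a) alg \<Rightarrow> 'a rel" where
  "nabla A = carr A \<times> carr A"

definition con_join :: "'f sig \<Rightarrow> ('f, 'a) alg \<Rightarrow> 'a rel \<Rightarrow> 'a rel \<Rightarrow> 'a rel" where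
  "con_join F A \<alpha> \<beta> = \<Inter>{\<theta> \<in> Con F A. \<alpha> \<union> \<beta> \<subseteq> \<theta>}"

text \<open>The meet in the congruence lattice is intersection.\<close>

definition Con_modular :: "'f sig \<Rightarrow> ('f, 'a) alg \<Rightarrow> bool" where
  "Con_modular F A \<longleftrightarrow> (\<forall>\<alpha>\<in>Con F A. \<forall>\<beta>\<in>Con F A. \<forall>\<gamma>\<in>Con F A. \<alpha> \<subseteq> \<gamma> \<longrightarrow>
     con_join F A \<alpha> (\<beta> \<inter> \<gamma>) = con_join F A \<alpha> \<beta> \<inter> \<gamma>)"

definition Con_distributive :: "'f sig \<Rightarrow> ('f, 'a) alg \<Rightarrow> bool" where
  "Con_distributive F A \<longleftrightarrow> (\<forall>\<alpha>\<in>Con F A. \<forall>\<beta>\<in>Con F A. \<forall>\<gamma>\<in>Con F A.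
     \<alpha> \<inter> con_join F A \<beta> \<gamma> = con_join F A (\<alpha> \<inter> \<beta>) (\<alpha> \<inter> \<gamma>))"

text \<open>A definition cannot quantify over all carrier types, so the following three properties of a
  class quantify over its members whose elements belong to the type of terms in countably many
  variables. Every countably generated member has an isomorphic copy there, which is enough: the
  lemmas \<open>congruence_modularD\<close>, \<open>congruence_distributiveD\<close> and \<open>semi_degenerateD\<close> below extend
  each property to the members of the class over an arbitrary carrier type.\<close>

definition congruence_modular :: "'f sig \<Rightarrow> 'f identities \<Rightarrow> bool" where
  "congruence_modular F E \<longleftrightarrow>
     (\<forall>A :: ('f, ('f, nat) trm) alg. A \<in> models F E \<longrightarrow> Con_modular F A)"

definition congruence_distributive :: "'f sig \<Rightarrow> 'f identities \<Rightarrow> bool" where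
  "congruence_distributive F E \<longleftrightarrow>
     (\<forall>A :: ('f, ('f, nat) trm) alg. A \<in> models F E \<longrightarrow> Con_distributive F A)"

definition semi_degenerate :: "'f sig \<Rightarrow> 'f identities \<Rightarrow> bool" where
  "semi_degenerate F E \<longleftrightarrow>
     (\<forall>A :: ('f, ('f, nat) trm) alg. A \<in> models F E \<longrightarrow> nontrivial A \<longrightarrow>
        \<not> (\<exists>e. subuniverse F A {e}))"


section \<open>Commutator and prime congruences\<close>

text \<open>The two tuples of variables are the two summands of \<^typ>\<open>nat + nat\<close>. Assigning values to
  infinitely many variables is harmless, since a term contains only finitely many of them.\<close>

definition centralizes ::
    "'f sig \<Rightarrow> ('f, 'a) alg \<Rightarrow> 'a rel \<Rightarrow> 'a rel \<Rightarrow> 'a rel \<Rightarrow> bool" where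
  "centralizes F A \<alpha> \<beta> \<delta> \<longleftrightarrow>
     (\<forall>(t :: ('f, nat + nat) trm) a b c d.
        wf_trm F t \<longrightarrow> (\<forall>i. (a i, b i) \<in> \<alpha>) \<longrightarrow> (\<forall>j. (c j, d j) \<in> \<beta>) \<longrightarrow>
        (eval A (case_sum a c) t, eval A (case_sum a d) t) \<in> \<delta> \<longrightarrow>
        (eval A (case_sum b c) t, eval A (case_sum b d) t) \<in> \<delta>)"

definition commutator :: "'f sig \<Rightarrow> ('f, 'a) alg \<Rightarrow> 'a rel \<Rightarrow> 'a rel \<Rightarrow> 'a rel" where
  "commutator F A \<alpha> \<beta> = \<Inter>{\<delta> \<in> Con F A. centralizes F A \<alpha> \<beta> \<delta>}"

definition Spec :: "'f sig \<Rightarrow> ('f, 'a) alg \<Rightarrow> 'a rel set" where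
  "Spec F A = {\<phi> \<in> Con F A. \<phi> \<noteq> nabla A \<and>
     (\<forall>\<alpha>\<in>Con F A. \<forall>\<beta>\<in>Con F A. commutator F A \<alpha> \<beta> \<subseteq> \<phi> \<longrightarrow> \<alpha> \<subseteq> \<phi> \<or> \<beta> \<subseteq> \<phi>)}"

definition pullback :: "('f, 'a) alg \<Rightarrow> ('a \<Rightarrow> 'b) \<Rightarrow> 'b rel \<Rightarrow> 'a rel" where
  "pullback A h \<psi> = {(x, y). x \<in> carr A \<and> y \<in> carr A \<and> (h x, h y) \<in> \<psi>}"

definition Ker :: "('f, 'a) alg \<Rightarrow> ('f, 'b) alg \<Rightarrow> ('a \<Rightarrow> 'b) \<Rightarrow> 'a rel" where
  "Ker A B h = pullback A h (Id_on (carr B))"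

definition admissible :: "'f sig \<Rightarrow> ('f, 'a) alg \<Rightarrow> ('f, 'b) alg \<Rightarrow> ('a \<Rightarrow> 'b) \<Rightarrow> bool" where
  "admissible F A B h \<longleftrightarrow> (\<forall>\<psi>\<in>Spec F B. pullback A h \<psi> \<in> Spec F A)"

definition GU :: "'f sig \<Rightarrow> ('f, 'a) alg \<Rightarrow> ('f, 'b) alg \<Rightarrow> ('a \<Rightarrow> 'b) \<Rightarrow> bool" where
  "GU F A B h \<longleftrightarrow>
     (\<forall>\<phi>\<in>Spec F A. \<forall>\<psi>\<in>Spec F A. \<forall>\<phi>\<^sub>1\<in>Spec F B. \<phi> \<subseteq> \<psi> \<longrightarrow> pullback A h \<phi>\<^sub>1 = \<phi> \<longrightarrow>
        (\<exists>\<psi>\<^sub>1\<in>Spec F B. \<phi>\<^sub>1 \<subseteq> \<psi>\<^sub>1 \<and> pullback A h \<psi>\<^sub>1 = \<psi>))"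

definition LO :: "'f sig \<Rightarrow> ('f, 'a) alg \<Rightarrow> ('f, 'b) alg \<Rightarrow> ('a \<Rightarrow> 'b) \<Rightarrow> bool" where
  "LO F A B h \<longleftrightarrow>
     (\<forall>\<phi>\<in>Spec F A. Ker A B h \<subseteq> \<phi> \<longrightarrow> (\<exists>\<phi>\<^sub>1\<in>Spec F B. pullback A h \<phi>\<^sub>1 = \<phi>))"


section \<open>Independence of the carrier type\<close>

lemma eval_in:
  assumes "closed_under F A S" "range v \<subseteq> S" "wf_trm F t"
  shows "eval A v t \<in> S"
  using assms(3)
proof (induction t)
  case (Var x) then show ?case using assms(2) by auto
next
  case (App f ts)
  have "set (map (eval A v) ts) \<subseteq> S" using App by auto
  moreover have "F f = Some (length (map (eval A v) ts))" using App by simp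
  ultimately have "interp A f (map (eval A v) ts) \<in> S"
    using assms(1) unfolding closed_under_def by blast
  then show ?case by simp
qed

lemma morphism_eval:
  assumes "morphism F A B h" "is_alg F A" "range v \<subseteq> carr A" "wf_trm F t"
  shows "h (eval A v t) = eval B (\<lambda>x. h (v x)) t"
  using assms(4)
proof (induction t)
  case (Var x) then show ?case by simp
next
  case (App f ts)
  have "set (map (eval A v) ts) \<subseteq> carr A"
    using App assms(2,3) eval_in[of F A "carr A" v] by (auto simp: is_alg_def)
  moreover have "F f = Some (length (map (eval A v) ts))" using App by simp
  ultimately have "h (interp A f (map (eval A v) ts)) = interp B f (map h (map (eval A v) ts))"
    using assms(1) unfolding morphism_def by blast
  moreover have "map h (map (eval A v) ts) = map (eval B (\<lambda>x. h (v x))) ts" using App by (auto simp: map_eq_conv)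
  ultimately show ?case by (metis eval.simps(2))
qed

lemma finite_subset_embedding:
  fixes A :: "('f, 'a) alg"
  assumes A: "A \<in> models F E" and E: "is_identities F E"
    and S: "finite S" "S \<subseteq> carr A"
  obtains A' :: "('f, ('f, nat) trm) alg" and g
  where "A' \<in> models F E" "morphism F A' A g" "inj_on g (carr A')" "S \<subseteq> g ` carr A'"
proof -
  have alg: "is_alg F A" using A by (simp add: models_def)
  then obtain a where a: "a \<in> carr A" by (auto simp: is_alg_def)
  obtain xs where xs: "set xs = S" using S(1) finite_list by blast
  define v where "v i = (if i < length xs then xs ! i else a)" for i
  have v: "range v \<subseteq> carr A" "S \<subseteq> range v"
    using a S(2) xs nth_mem by (fastforce simp: v_def, force simp: v_def in_set_conv_nth)
  define W where "W = {t :: ('f, nat) trm. wf_trm F t}"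
  define g where "g = eval A v"
  define rep where "rep = inv_into W g"
  have rep: "rep b \<in> W" "g (rep b) = b" if "b \<in> g ` W" for b
    using that by (auto simp: rep_def inv_into_into f_inv_into_f)
  define A' where "A' = \<lparr>carr = rep ` (g ` W), interp = (\<lambda>f ts. rep (interp A f (map g ts)))\<rparr>"
  have carr: "carr A' \<subseteq> W" using rep by (auto simp: A'_def)
  have gcarr: "g ` carr A' = g ` W" using rep by (auto simp: A'_def image_iff)
  have inj: "inj_on g (carr A')" using rep by (auto simp: A'_def inj_on_def)
  have cl: "interp A f (map g ts) \<in> g ` W" if "F f = Some (length ts)" "set ts \<subseteq> carr A'" for f ts
  proof -
    have "App f ts \<in> W" using that carr by (auto simp: W_def)
    moreover have "g (App f ts) = interp A f (map g ts)" by (simp add: g_def)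
    ultimately show ?thesis by (metis imageI)
  qed
  have "rep (g (Var 0)) \<in> carr A'" by (auto simp: A'_def W_def)
  then have alg': "is_alg F A'" using cl by (auto simp: is_alg_def closed_under_def A'_def)
  have "g ` W \<subseteq> carr A"
    using alg v(1) by (auto simp: g_def W_def is_alg_def intro: eval_in)
  then have mor: "morphism F A' A g"
    using gcarr cl rep(2) by (auto simp: morphism_def A'_def)
  have "eval A' w s = eval A' w t" if st: "(s, t) \<in> E" and w: "range w \<subseteq> carr A'" for s t w
  proof -
    have wf: "wf_trm F s" "wf_trm F t" using st E by (auto simp: is_identities_def)
    have "range (\<lambda>x. g (w x)) \<subseteq> carr A" using w mor by (auto simp: morphism_def)
    then have "g (eval A' w s) = g (eval A' w t)"
      using A st morphism_eval[OF mor alg' w wf(1)] morphism_eval[OF mor alg' w wf(2)]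
      by (auto simp: models_def)
    moreover have "eval A' w s \<in> carr A'" "eval A' w t \<in> carr A'"
      using alg' w wf by (auto simp: is_alg_def intro: eval_in)
    ultimately show ?thesis using inj by (meson inj_onD)
  qed
  then have "A' \<in> models F E" using alg' by (auto simp: models_def)
  moreover have "S \<subseteq> g ` carr A'"
  proof
    fix x assume "x \<in> S"
    then obtain i where "x = v i" using v(2) by auto
    then have "x = g (Var i)" by (simp add: g_def)
    then show "x \<in> g ` carr A'" unfolding gcarr by (auto simp: W_def)
  qed
  ultimately show ?thesis using that mor inj by blast
qed

lemma Con_D:
  assumes "\<theta> \<in> Con F A"
  shows "\<theta> \<subseteq> carr A \<times> carr A" "x \<in> carr A \<Longrightarrow> (x, x) \<in> \<theta>" "(x, y) \<in> \<theta> \<Longrightarrow> (y, x) \<in> \<theta>"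
    "(x, y) \<in> \<theta> \<Longrightarrow> (y, z) \<in> \<theta> \<Longrightarrow> (x, z) \<in> \<theta>"
    "F f = Some (length xs) \<Longrightarrow> list_all2 (\<lambda>x y. (x, y) \<in> \<theta>) xs ys \<Longrightarrow>
      (interp A f xs, interp A f ys) \<in> \<theta>"
  using assms by (auto simp: Con_def equiv_def refl_on_def dest: symD transD)

lemma Con_I:
  assumes "\<theta> \<subseteq> carr A \<times> carr A" "\<And>x. x \<in> carr A \<Longrightarrow> (x, x) \<in> \<theta>"
    "\<And>x y. (x, y) \<in> \<theta> \<Longrightarrow> (y, x) \<in> \<theta>"
    "\<And>x y z. (x, y) \<in> \<theta> \<Longrightarrow> (y, z) \<in> \<theta> \<Longrightarrow> (x, z) \<in> \<theta>"
    "\<And>f xs ys. F f = Some (length xs) \<Longrightarrow> list_all2 (\<lambda>x y. (x, y) \<in> \<theta>) xs ys \<Longrightarrow>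
      (interp A f xs, interp A f ys) \<in> \<theta>"
  shows "\<theta> \<in> Con F A"
proof -
  have "sym \<theta>" using assms(3) by (rule symI)
  moreover have "trans \<theta>" using assms(4) by (rule transI)
  ultimately show ?thesis
    using assms(1,2,5) unfolding Con_def equiv_def refl_on_def by blast
qed

lemma nabla_in_Con:
  assumes "is_alg F A" shows "nabla A \<in> Con F A"
proof (rule Con_I)
  fix f xs ys
  assume f: "F f = Some (length xs)" and "list_all2 (\<lambda>x y. (x, y) \<in> nabla A) xs ys"
  then have "length xs = length ys" "set xs \<subseteq> carr A" "set ys \<subseteq> carr A"
    by (auto simp: list_all2_conv_all_nth nabla_def in_set_conv_nth)
  then show "(interp A f xs, interp A f ys) \<in> nabla A"
    using assms f unfolding nabla_def is_alg_def closed_under_def by auto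
qed (auto simp: nabla_def)

lemma Inter_Con:
  assumes "T \<subseteq> Con F A" "T \<noteq> {}" shows "\<Inter>T \<in> Con F A"
proof (rule Con_I)
  fix f xs ys
  assume f: "F f = Some (length xs)" and l: "list_all2 (\<lambda>x y. (x, y) \<in> \<Inter>T) xs ys"
  show "(interp A f xs, interp A f ys) \<in> \<Inter>T"
  proof
    fix \<theta> assume T: "\<theta> \<in> T"
    then have "\<theta> \<in> Con F A" using assms(1) by blast
    moreover have "list_all2 (\<lambda>x y. (x, y) \<in> \<theta>) xs ys"
      using l T by (auto simp: list_all2_conv_all_nth)
    ultimately show "(interp A f xs, interp A f ys) \<in> \<theta>" using f Con_D(5) by metis
  qed
next
  obtain \<theta> where "\<theta> \<in> T" using assms(2) by auto
  moreover from this have "\<theta> \<subseteq> carr A \<times> carr A" using assms(1) Con_D(1) by (metis subsetD)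
  ultimately show "\<Inter>T \<subseteq> carr A \<times> carr A" by auto
next
  fix x assume "x \<in> carr A"
  then show "(x, x) \<in> \<Inter>T" using assms(1) by (intro InterI Con_D(2)) auto
next
  fix x y assume "(x, y) \<in> \<Inter>T"
  then show "(y, x) \<in> \<Inter>T" using assms(1) by (intro InterI Con_D(3)[of _ F A x y]) auto
next
  fix x y z assume "(x, y) \<in> \<Inter>T" "(y, z) \<in> \<Inter>T"
  then show "(x, z) \<in> \<Inter>T" using assms(1) by (intro InterI Con_D(4)[of _ F A x y z]) auto
qed

lemma Int_Con: "\<alpha> \<in> Con F A \<Longrightarrow> \<beta> \<in> Con F A \<Longrightarrow> \<alpha> \<inter> \<beta> \<in> Con F A"
  using Inter_Con[of "{\<alpha>, \<beta>}" F A] by simp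

lemma con_join_in_Con:
  assumes "is_alg F A" "\<alpha> \<in> Con F A" "\<beta> \<in> Con F A"
  shows "con_join F A \<alpha> \<beta> \<in> Con F A"
proof -
  have "nabla A \<in> {\<theta> \<in> Con F A. \<alpha> \<union> \<beta> \<subseteq> \<theta>}"
    using nabla_in_Con[OF assms(1)] Con_D(1)[OF assms(2)] Con_D(1)[OF assms(3)]
    by (auto simp: nabla_def)
  then show ?thesis unfolding con_join_def by (intro Inter_Con) auto
qed

lemma con_join_upper: "\<alpha> \<union> \<beta> \<subseteq> con_join F A \<alpha> \<beta>"
  by (auto simp: con_join_def)

lemma con_join_least: "\<theta> \<in> Con F A \<Longrightarrow> \<alpha> \<union> \<beta> \<subseteq> \<theta> \<Longrightarrow> con_join F A \<alpha> \<beta> \<subseteq> \<theta>"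
  by (auto simp: con_join_def)

lemma commutator_least:
  fixes A :: "('f, 'a) alg"
  assumes A: "is_alg F A" and \<alpha>: "\<alpha> \<in> Con F A" and \<beta>: "\<beta> \<in> Con F A"
  shows "commutator F A \<alpha> \<beta> \<in> Con F A" "centralizes F A \<alpha> \<beta> (commutator F A \<alpha> \<beta>)"
    "\<delta> \<in> Con F A \<Longrightarrow> centralizes F A \<alpha> \<beta> \<delta> \<Longrightarrow> commutator F A \<alpha> \<beta> \<subseteq> \<delta>"
proof -
  show "centralizes F A \<alpha> \<beta> (commutator F A \<alpha> \<beta>)"
    unfolding commutator_def centralizes_def by blast
  show "\<delta> \<in> Con F A \<Longrightarrow> centralizes F A \<alpha> \<beta> \<delta> \<Longrightarrow> commutator F A \<alpha> \<beta> \<subseteq> \<delta>"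
    by (auto simp: commutator_def)
  have "centralizes F A \<alpha> \<beta> (nabla A)"
    unfolding centralizes_def
  proof (intro allI impI)
    fix t :: "('f, nat + nat) trm" and a b c d :: "nat \<Rightarrow> 'a"
    assume t: "wf_trm F t" and ab: "\<forall>i. (a i, b i) \<in> \<alpha>" and cd: "\<forall>j. (c j, d j) \<in> \<beta>"
    have "b i \<in> carr A" "c i \<in> carr A" "d i \<in> carr A" for i
      using ab cd Con_D(1)[OF \<alpha>] Con_D(1)[OF \<beta>] by blast+
    then have "range (case_sum b c) \<subseteq> carr A" "range (case_sum b d) \<subseteq> carr A"
      by (auto split: sum.splits)
    then show "(eval A (case_sum b c) t, eval A (case_sum b d) t) \<in> nabla A"
      using A t by (auto simp: nabla_def is_alg_def intro: eval_in)
  qed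
  then show "commutator F A \<alpha> \<beta> \<in> Con F A"
    unfolding commutator_def using nabla_in_Con[OF A] by (intro Inter_Con) auto
qed

lemma pullback_in_Con:
  assumes A: "is_alg F A" and h: "morphism F A B h" and \<psi>: "\<psi> \<in> Con F B"
  shows "pullback A h \<psi> \<in> Con F A"
proof (rule Con_I)
  show "pullback A h \<psi> \<subseteq> carr A \<times> carr A" by (auto simp: pullback_def)
next
  fix x assume "x \<in> carr A"
  then show "(x, x) \<in> pullback A h \<psi>"
    using h Con_D(2)[OF \<psi>] by (auto simp: pullback_def morphism_def)
next
  fix x y assume "(x, y) \<in> pullback A h \<psi>"
  then show "(y, x) \<in> pullback A h \<psi>" using Con_D(3)[OF \<psi>] by (auto simp: pullback_def)
next
  fix x y z assume "(x, y) \<in> pullback A h \<psi>" "(y, z) \<in> pullback A h \<psi>"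
  then show "(x, z) \<in> pullback A h \<psi>" using Con_D(4)[OF \<psi>] by (auto simp: pullback_def)
next
  fix f xs ys
  assume f: "F f = Some (length xs)" and l: "list_all2 (\<lambda>x y. (x, y) \<in> pullback A h \<psi>) xs ys"
  then have len: "length xs = length ys" and sub: "set xs \<subseteq> carr A" "set ys \<subseteq> carr A"
    by (auto simp: list_all2_conv_all_nth pullback_def in_set_conv_nth)
  have "list_all2 (\<lambda>x y. (x, y) \<in> \<psi>) (map h xs) (map h ys)"
    using l by (auto simp: list_all2_conv_all_nth pullback_def)
  then have "(interp B f (map h xs), interp B f (map h ys)) \<in> \<psi>"
    using Con_D(5)[OF \<psi>, of f "map h xs"] f by simp
  then show "(interp A f xs, interp A f ys) \<in> pullback A h \<psi>"
    using A h f len sub by (simp add: pullback_def morphism_def is_alg_def closed_under_def)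
qed

text \<open>Membership in a join of congruences is witnessed by finitely many elements.\<close>

lemma con_join_finitary:
  fixes A :: "('f, 'a) alg"
  assumes A: "A \<in> models F E" and E: "is_identities F E"
    and \<alpha>: "\<alpha> \<in> Con F A" and \<beta>: "\<beta> \<in> Con F A" and xy: "(x, y) \<in> con_join F A \<alpha> \<beta>"
  obtains A' :: "('f, ('f, nat) trm) alg" and g u w
  where "A' \<in> models F E" "morphism F A' A g" "u \<in> carr A'" "w \<in> carr A'" "g u = x" "g w = y"
    "(u, w) \<in> con_join F A' (pullback A' g \<alpha>) (pullback A' g \<beta>)"
proof -
  have alg: "is_alg F A" using A by (simp add: models_def)
  define P where "P S x y \<longleftrightarrow>
     (\<forall>(A' :: ('f, ('f, nat) trm) alg) g u w. A' \<in> models F E \<longrightarrow> morphism F A' A g \<longrightarrow>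
        inj_on g (carr A') \<longrightarrow> S \<subseteq> g ` carr A' \<longrightarrow> u \<in> carr A' \<longrightarrow> w \<in> carr A' \<longrightarrow> g u = x \<longrightarrow> g w = y \<longrightarrow>
        (u, w) \<in> con_join F A' (pullback A' g \<alpha>) (pullback A' g \<beta>))" for S x y
  define R where "R = {(x, y). x \<in> carr A \<and> y \<in> carr A \<and>
     (\<exists>S. finite S \<and> S \<subseteq> carr A \<and> P S x y)}"
  have con: "con_join F A' (pullback A' g \<alpha>) (pullback A' g \<beta>) \<in> Con F A'"
    if "A' \<in> models F E" "morphism F A' A g" for A' :: "('f, ('f, nat) trm) alg" and g
    using that by (auto simp: models_def intro!: con_join_in_Con pullback_in_Con[OF _ _ \<alpha>] pullback_in_Con[OF _ _ \<beta>])
  have incl: "(x, y) \<in> R" if "(x, y) \<in> \<alpha> \<union> \<beta>" for x y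
  proof -
    have "P {} x y" unfolding P_def
    proof (intro allI impI)
      fix A' :: "('f, ('f, nat) trm) alg" and g u w
      assume "u \<in> carr A'" "w \<in> carr A'" "g u = x" "g w = y"
      then have "(u, w) \<in> pullback A' g \<alpha> \<union> pullback A' g \<beta>" using that by (auto simp: pullback_def)
      then show "(u, w) \<in> con_join F A' (pullback A' g \<alpha>) (pullback A' g \<beta>)"
        using con_join_upper by blast
    qed
    moreover have "x \<in> carr A" "y \<in> carr A" using that Con_D(1)[OF \<alpha>] Con_D(1)[OF \<beta>] by auto
    ultimately show ?thesis unfolding R_def by blast
  qed
  have "R \<in> Con F A"
  proof (rule Con_I)
    show "R \<subseteq> carr A \<times> carr A" by (auto simp: R_def)
  next
    fix x assume "x \<in> carr A"
    then show "(x, x) \<in> R" using incl Con_D(2)[OF \<alpha>] by blast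
  next
    fix x y assume "(x, y) \<in> R"
    then obtain S where S: "x \<in> carr A" "y \<in> carr A" "finite S" "S \<subseteq> carr A" "P S x y"
      by (auto simp: R_def)
    have "P S y x" using S(5) Con_D(3)[OF con] unfolding P_def by simp
    then show "(y, x) \<in> R" using S by (auto simp: R_def)
  next
    fix x y z assume "(x, y) \<in> R" "(y, z) \<in> R"
    then obtain S T where S: "x \<in> carr A" "y \<in> carr A" "finite S" "S \<subseteq> carr A" "P S x y"
      and T: "z \<in> carr A" "finite T" "T \<subseteq> carr A" "P T y z"
      by (auto simp: R_def)
    have "P (insert y (S \<union> T)) x z" unfolding P_def
    proof (intro allI impI)
      fix A' :: "('f, ('f, nat) trm) alg" and g u w
      assume *: "A' \<in> models F E" "morphism F A' A g" "inj_on g (carr A')"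
        "insert y (S \<union> T) \<subseteq> g ` carr A'" "u \<in> carr A'" "w \<in> carr A'" "g u = x" "g w = z"
      then obtain m where m: "m \<in> carr A'" "g m = y" by auto
      have "(u, m) \<in> con_join F A' (pullback A' g \<alpha>) (pullback A' g \<beta>)"
        using S(5) * m unfolding P_def by simp
      moreover have "(m, w) \<in> con_join F A' (pullback A' g \<alpha>) (pullback A' g \<beta>)"
        using T(4) * m unfolding P_def by simp
      ultimately show "(u, w) \<in> con_join F A' (pullback A' g \<alpha>) (pullback A' g \<beta>)"
        using Con_D(4)[OF con[OF *(1,2)]] by blast
    qed
    moreover have "finite (insert y (S \<union> T))" "insert y (S \<union> T) \<subseteq> carr A" using S T by auto
    ultimately show "(x, z) \<in> R" using S(1) T(1) unfolding R_def by blast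
  next
    fix f xs ys
    assume f: "F f = Some (length xs)" and l: "list_all2 (\<lambda>x y. (x, y) \<in> R) xs ys"
    have len: "length ys = length xs" using l by (simp add: list_all2_lengthD)
    have "\<forall>i<length xs. \<exists>S. finite S \<and> S \<subseteq> carr A \<and> P S (xs ! i) (ys ! i)"
      using l by (auto simp: list_all2_conv_all_nth R_def)
    then obtain S where S: "\<And>i. i < length xs \<Longrightarrow>
        finite (S i) \<and> S i \<subseteq> carr A \<and> P (S i) (xs ! i) (ys ! i)"
      by metis
    define T where "T = set xs \<union> set ys \<union> (\<Union>i<length xs. S i)"
    have sub: "set xs \<subseteq> carr A" "set ys \<subseteq> carr A"
      using l by (auto simp: list_all2_conv_all_nth R_def in_set_conv_nth)
    have "\<And>i. i < length xs \<Longrightarrow> finite (S i)" "\<And>i. i < length xs \<Longrightarrow> S i \<subseteq> carr A"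
      using S by blast+
    then have T: "finite T" "T \<subseteq> carr A"
      unfolding T_def using sub by (simp, simp add: UN_subset_iff)
    have "P T (interp A f xs) (interp A f ys)" unfolding P_def
    proof (intro allI impI)
      fix A' :: "('f, ('f, nat) trm) alg" and g u w
      assume *: "A' \<in> models F E" "morphism F A' A g" "inj_on g (carr A')"
        "T \<subseteq> g ` carr A'" "u \<in> carr A'" "w \<in> carr A'" "g u = interp A f xs" "g w = interp A f ys"
      have lift: "\<exists>us. set us \<subseteq> carr A' \<and> map g us = zs" if "set zs \<subseteq> g ` carr A'" for zs
        using that by (induction zs) (force, metis image_iff insert_subset list.set(2) list.simps(9))
      obtain us where us: "set us \<subseteq> carr A'" "map g us = xs" using lift[of xs] *(4) by (auto simp: T_def)
      obtain ws where ws: "set ws \<subseteq> carr A'" "map g ws = ys" using lift[of ys] *(4) by (auto simp: T_def)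
      have lens: "length us = length xs" "length ws = length xs" using us ws len by auto
      let ?J = "con_join F A' (pullback A' g \<alpha>) (pullback A' g \<beta>)"
      have "(us ! i, ws ! i) \<in> ?J" if i: "i < length xs" for i
      proof -
        have "S i \<subseteq> g ` carr A'" using *(4) i by (auto simp: T_def)
        moreover have "us ! i \<in> carr A'" "ws ! i \<in> carr A'" using us ws lens i by auto
        moreover have "g (us ! i) = xs ! i" "g (ws ! i) = ys ! i"
          using us(2) ws(2) lens i by (metis nth_map)+
        ultimately show ?thesis using S[OF i] *(1-3) unfolding P_def by simp
      qed
      then have "list_all2 (\<lambda>x y. (x, y) \<in> ?J) us ws" using lens by (simp add: list_all2_conv_all_nth)
      then have J: "(interp A' f us, interp A' f ws) \<in> ?J"
        using Con_D(5)[OF con[OF *(1,2)]] f lens by simp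
      have in': "interp A' f us \<in> carr A'" "interp A' f ws \<in> carr A'"
        using J Con_D(1)[OF con[OF *(1,2)]] by auto
      have "g (interp A' f us) = g u" "g (interp A' f ws) = g w"
        using *(2,7,8) us ws f lens unfolding morphism_def by auto
      then have "interp A' f us = u" "interp A' f ws = w"
        using *(3,5,6) in' by (meson inj_onD)+
      then show "(u, w) \<in> ?J" using J by simp
    qed
    moreover have "interp A f xs \<in> carr A" "interp A f ys \<in> carr A"
      using alg sub f len by (auto simp: is_alg_def closed_under_def)
    ultimately show "(interp A f xs, interp A f ys) \<in> R" using T unfolding R_def by blast
  qed
  moreover have "\<alpha> \<union> \<beta> \<subseteq> R" using incl by (intro subrelI)
  ultimately have "(x, y) \<in> R" using xy con_join_least[of R F A \<alpha> \<beta>] by blast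
  then obtain S where S: "x \<in> carr A" "y \<in> carr A" "finite S" "S \<subseteq> carr A" "P S x y"
    by (auto simp: R_def)
  obtain A' :: "('f, ('f, nat) trm) alg" and g where
    A': "A' \<in> models F E" "morphism F A' A g" "inj_on g (carr A')" "insert x (insert y S) \<subseteq> g ` carr A'"
    using finite_subset_embedding[OF A E, of "insert x (insert y S)"] S by auto
  then obtain u w where uw: "u \<in> carr A'" "w \<in> carr A'" "g u = x" "g w = y"
    by (metis image_iff insert_subset)
  have "(u, w) \<in> con_join F A' (pullback A' g \<alpha>) (pullback A' g \<beta>)"
    using S(5) A' uw unfolding P_def by simp
  then show ?thesis using that[OF A'(1,2) uw] by blast
qed

lemma pullback_con_join:
  assumes A: "is_alg F A" and A': "is_alg F A'" and g: "morphism F A' A g"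
    and \<alpha>: "\<alpha> \<in> Con F A" and \<beta>: "\<beta> \<in> Con F A"
  shows "con_join F A' (pullback A' g \<alpha>) (pullback A' g \<beta>) \<subseteq> pullback A' g (con_join F A \<alpha> \<beta>)"
proof (rule con_join_least)
  show "pullback A' g (con_join F A \<alpha> \<beta>) \<in> Con F A'"
    by (rule pullback_in_Con[OF A' g con_join_in_Con[OF A \<alpha> \<beta>]])
  show "pullback A' g \<alpha> \<union> pullback A' g \<beta> \<subseteq> pullback A' g (con_join F A \<alpha> \<beta>)"
    using con_join_upper[of \<alpha> \<beta> F A] by (auto simp: pullback_def)
qed

lemma pullback_Int: "pullback A h (\<alpha> \<inter> \<beta>) = pullback A h \<alpha> \<inter> pullback A h \<beta>"
  by (auto simp: pullback_def)

theorem congruence_modularD: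
  fixes A :: "('f, 'a) alg"
  assumes "congruence_modular F E" and E: "is_identities F E" and A: "A \<in> models F E"
  shows "Con_modular F A"
  unfolding Con_modular_def
proof (intro ballI impI equalityI)
  fix \<alpha> \<beta> \<gamma> assume c: "\<alpha> \<in> Con F A" "\<beta> \<in> Con F A" "\<gamma> \<in> Con F A" "\<alpha> \<subseteq> \<gamma>"
  have alg: "is_alg F A" using A by (simp add: models_def)
  show "con_join F A \<alpha> (\<beta> \<inter> \<gamma>) \<subseteq> con_join F A \<alpha> \<beta> \<inter> \<gamma>"
    using c con_join_upper[of \<alpha> \<beta> F A]
    by (intro con_join_least Int_Con con_join_in_Con alg) auto
  show "con_join F A \<alpha> \<beta> \<inter> \<gamma> \<subseteq> con_join F A \<alpha> (\<beta> \<inter> \<gamma>)"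
  proof (rule subrelI)
    fix x y assume xy: "(x, y) \<in> con_join F A \<alpha> \<beta> \<inter> \<gamma>"
    then obtain A' :: "('f, ('f, nat) trm) alg" and g u w where
      A': "A' \<in> models F E" and g: "morphism F A' A g"
      and uw: "u \<in> carr A'" "w \<in> carr A'" "g u = x" "g w = y"
        "(u, w) \<in> con_join F A' (pullback A' g \<alpha>) (pullback A' g \<beta>)"
      using con_join_finitary[OF A E c(1,2)] by blast
    have alg': "is_alg F A'" using A' by (simp add: models_def)
    have "Con_modular F A'" using assms(1) A' by (simp add: congruence_modular_def)
    moreover have "pullback A' g \<alpha> \<subseteq> pullback A' g \<gamma>" using c(4) by (auto simp: pullback_def)
    moreover have "(u, w) \<in> pullback A' g \<gamma>" using xy uw by (auto simp: pullback_def)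
    ultimately have "(u, w) \<in> con_join F A' (pullback A' g \<alpha>) (pullback A' g (\<beta> \<inter> \<gamma>))"
      using uw(5) c pullback_in_Con[OF alg' g] by (simp add: Con_modular_def pullback_Int)
    then show "(x, y) \<in> con_join F A \<alpha> (\<beta> \<inter> \<gamma>)"
      using pullback_con_join[OF alg alg' g c(1) Int_Con[OF c(2,3)]] uw(3,4)
      by (auto simp: pullback_def)
  qed
qed

theorem congruence_distributiveD:
  fixes A :: "('f, 'a) alg"
  assumes "congruence_distributive F E" and E: "is_identities F E" and A: "A \<in> models F E"
  shows "Con_distributive F A"
  unfolding Con_distributive_def
proof (intro ballI impI equalityI)
  fix \<alpha> \<beta> \<gamma> assume c: "\<alpha> \<in> Con F A" "\<beta> \<in> Con F A" "\<gamma> \<in> Con F A"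
  have alg: "is_alg F A" using A by (simp add: models_def)
  show "con_join F A (\<alpha> \<inter> \<beta>) (\<alpha> \<inter> \<gamma>) \<subseteq> \<alpha> \<inter> con_join F A \<beta> \<gamma>"
    using c con_join_upper[of \<beta> \<gamma> F A]
    by (intro con_join_least Int_Con con_join_in_Con alg) auto
  show "\<alpha> \<inter> con_join F A \<beta> \<gamma> \<subseteq> con_join F A (\<alpha> \<inter> \<beta>) (\<alpha> \<inter> \<gamma>)"
  proof (rule subrelI)
    fix x y assume xy: "(x, y) \<in> \<alpha> \<inter> con_join F A \<beta> \<gamma>"
    then obtain A' :: "('f, ('f, nat) trm) alg" and g u w where
      A': "A' \<in> models F E" and g: "morphism F A' A g"
      and uw: "u \<in> carr A'" "w \<in> carr A'" "g u = x" "g w = y"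
        "(u, w) \<in> con_join F A' (pullback A' g \<beta>) (pullback A' g \<gamma>)"
      using con_join_finitary[OF A E c(2,3)] by blast
    have alg': "is_alg F A'" using A' by (simp add: models_def)
    have "Con_distributive F A'" using assms(1) A' by (simp add: congruence_distributive_def)
    then have "pullback A' g \<alpha> \<inter> con_join F A' (pullback A' g \<beta>) (pullback A' g \<gamma>) =
        con_join F A' (pullback A' g (\<alpha> \<inter> \<beta>)) (pullback A' g (\<alpha> \<inter> \<gamma>))"
      using c pullback_in_Con[OF alg' g] by (simp add: Con_distributive_def pullback_Int)
    moreover have "(u, w) \<in> pullback A' g \<alpha>" using xy uw by (auto simp: pullback_def)
    ultimately have "(u, w) \<in> con_join F A' (pullback A' g (\<alpha> \<inter> \<beta>)) (pullback A' g (\<alpha> \<inter> \<gamma>))"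
      using uw(5) by blast
    then show "(x, y) \<in> con_join F A (\<alpha> \<inter> \<beta>) (\<alpha> \<inter> \<gamma>)"
      using pullback_con_join[OF alg alg' g Int_Con[OF c(1,2)] Int_Con[OF c(1,3)]] uw(3,4)
      by (auto simp: pullback_def)
  qed
qed

theorem semi_degenerateD:
  fixes A :: "('f, 'a) alg"
  assumes "semi_degenerate F E" and E: "is_identities F E" and A: "A \<in> models F E"
    and "nontrivial A"
  shows "\<not> (\<exists>e. subuniverse F A {e})"
proof
  assume "\<exists>e. subuniverse F A {e}"
  then obtain e where e: "e \<in> carr A" "closed_under F A {e}" by (auto simp: subuniverse_def)
  obtain x y where xy: "x \<in> carr A" "y \<in> carr A" "x \<noteq> y" using assms(4) by (auto simp: nontrivial_def)
  obtain A' :: "('f, ('f, nat) trm) alg" and g where A': "A' \<in> models F E" and g: "morphism F A' A g" "inj_on g (carr A')"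
    "{e, x, y} \<subseteq> g ` carr A'"
    using finite_subset_embedding[OF A E, of "{e, x, y}"] e xy by auto
  from g(3) obtain e' where e': "e' \<in> carr A'" "g e' = e" by auto
  have alg': "is_alg F A'" using A' by (simp add: models_def)
  have "interp A' f us = e'" if f: "F f = Some (length us)" and us: "set us \<subseteq> {e'}" for f us
  proof -
    have in': "set us \<subseteq> carr A'" using us e' by auto
    have "set (map g us) \<subseteq> {e}" "F f = Some (length (map g us))" using us e' f by auto
    then have "interp A f (map g us) \<in> {e}" using e(2) unfolding closed_under_def by blast
    then have "g (interp A' f us) = g e'"
      using g(1) f in' e'(2) unfolding morphism_def by auto
    moreover have "interp A' f us \<in> carr A'" using alg' f in' by (auto simp: is_alg_def closed_under_def)
    ultimately show ?thesis using g(2) e'(1) by (meson inj_onD)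
  qed
  then have "subuniverse F A' {e'}" using e' by (auto simp: subuniverse_def closed_under_def)
  moreover have "nontrivial A'" using g(3) xy(3) unfolding nontrivial_def by (metis image_iff insert_subset)
  ultimately show False using assms(1) A' by (auto simp: semi_degenerate_def)
qed

end

theory Submission
  imports Defs
begin

text \<open>For \<open>h : M \<rightarrow> N\<close> surjective, Spec of \<open>N\<close> is the part of Spec of \<open>M\<close> above the kernel. That a
  prime congruence \<open>\<phi>\<close> containing the kernel has a prime image holds in any variety, as centralizing
  pulls back along \<open>h\<close>. Conversely, let \<open>\<psi>\<close> be prime in \<open>N\<close> and \<open>[\<alpha>, \<beta>]\<close> below its pullback \<open>\<phi>\<close>. Day's
  terms for congruence modularity make the centralizing relation symmetric and monotone, so \<open>\<alpha>\<close>
  centralizes \<open>\<beta>\<close> modulo \<open>\<phi>\<close>, hence the images of \<open>\<alpha>\<close> and \<open>\<beta>\<close> centralize each other modulo \<open>\<psi>\<close>;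
  by symmetry both can be enlarged to congruences, to which primeness of \<open>\<psi>\<close> applies.

  For the converse, take algebras with a majority operation \<open>m\<close> and constants \<open>0, 1\<close> satisfying
  \<open>m(0, x, 1) = x\<close>. Majority gives distributivity and the identity gives semi-degeneracy. An
  inclusion of one nontrivial simple algebra into another satisfies all the conditions, since
  equality is the only prime congruence of each.\<close>

section \<open>Terms\<close>

fun tsubst :: "('v \<Rightarrow> ('f, 'w) trm) \<Rightarrow> ('f, 'v) trm \<Rightarrow> ('f, 'w) trm" where
  "tsubst \<sigma> (Var x) = \<sigma> x"
| "tsubst \<sigma> (App f ts) = App f (map (tsubst \<sigma>) ts)"

lemma eval_tsubst: "eval A v (tsubst \<sigma> t) = eval A (\<lambda>x. eval A v (\<sigma> x)) t"
proof (induction t)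
  case (App f ts)
  then show ?case by (auto intro!: arg_cong[where f = "interp A f"])
qed simp

lemma wf_tsubst: "wf_trm F t \<Longrightarrow> (\<And>x. wf_trm F (\<sigma> x)) \<Longrightarrow> wf_trm F (tsubst \<sigma> t)"
  by (induction t) auto

lemma eval_cong_vars: "(\<And>x. x \<in> set2_trm t \<Longrightarrow> v x = w x) \<Longrightarrow> eval A v t = eval A w t"
proof (induction t)
  case (App f ts)
  have "eval A v s = eval A w s" if "s \<in> set ts" for s
    using that App.prems by (intro App.IH) auto
  then show ?case by (auto intro!: arg_cong[where f = "interp A f"])
qed simp

lemma finite_vars: "finite (set2_trm t)"
  by (induction t) auto

lemma eval_Con:
  assumes \<theta>: "\<theta> \<in> Con F A" and vw: "\<And>x. (v x, w x) \<in> \<theta>" and t: "wf_trm F t"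
  shows "(eval A v t, eval A w t) \<in> \<theta>"
  using t
proof (induction t)
  case (App f ts)
  then have "list_all2 (\<lambda>x y. (x, y) \<in> \<theta>) (map (eval A v) ts) (map (eval A w) ts)"
    by (auto simp: list_all2_conv_all_nth)
  then show ?case using Con_D(5)[OF \<theta>, of f "map (eval A v) ts"] App.prems by simp
qed (simp add: vw)


section \<open>Joins of congruences\<close>

text \<open>The transitive closure of the union is itself a congruence: an operation respects it
  because its arguments can be changed one at a time, each along its own chain, while reflexivity
  holds the others fixed.\<close>

lemma con_join_subset_trancl:
  assumes A: "is_alg F A" and \<alpha>: "\<alpha> \<in> Con F A" and \<beta>: "\<beta> \<in> Con F A"
  shows "con_join F A \<alpha> \<beta> \<subseteq> (\<alpha> \<union> \<beta>)\<^sup>+"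
proof (rule con_join_least)
  let ?S = "\<alpha> \<union> \<beta>"
  have sub: "?S \<subseteq> carr A \<times> carr A" using Con_D(1)[OF \<alpha>] Con_D(1)[OF \<beta>] by blast
  have sub_trancl: "?S\<^sup>+ \<subseteq> carr A \<times> carr A" using trancl_subset_Sigma[OF sub] .
  have refl: "(x, x) \<in> ?S\<^sup>+" if "x \<in> carr A" for x using that Con_D(2)[OF \<alpha>] by blast
  have one: "(interp A f (us @ x # vs), interp A f (us @ y # vs)) \<in> \<theta>"
    if \<theta>: "\<theta> \<in> Con F A" and f: "F f = Some (length (us @ x # vs))"
      and c: "set us \<subseteq> carr A" "set vs \<subseteq> carr A" and xy: "(x, y) \<in> \<theta>" for \<theta> f us x vs y
  proof -
    have "list_all2 (\<lambda>x y. (x, y) \<in> \<theta>) us us" "list_all2 (\<lambda>x y. (x, y) \<in> \<theta>) vs vs"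
      using c Con_D(2)[OF \<theta>] by (auto intro!: list_all2_refl simp: list_all2_same)
    then show ?thesis
      using Con_D(5)[OF \<theta> f] xy by (simp add: list_all2_appendI)
  qed
  have step: "(interp A f (us @ x # vs), interp A f (us @ y # vs)) \<in> ?S\<^sup>+"
    if "(x, y) \<in> ?S\<^sup>+" and f: "F f = Some (length (us @ x # vs))"
      and c: "set us \<subseteq> carr A" "set vs \<subseteq> carr A" for f us x vs y
    using that(1)
  proof (induction rule: trancl_induct)
    case (base y)
    then show ?case using one[OF \<alpha> f c] one[OF \<beta> f c] by blast
  next
    case (step y z)
    have "F f = Some (length (us @ y # vs))" using f by simp
    then have "(interp A f (us @ y # vs), interp A f (us @ z # vs)) \<in> ?S"
      using one[OF \<alpha> _ c] one[OF \<beta> _ c] step(2) by blast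
    then show ?case using step(3) by (rule trancl_into_trancl[rotated])
  qed
  \<comment> \<open>\<open>us\<close> collects the arguments already replaced, so that the induction
    can run along the rest of the list.\<close>
  have many: "(interp A f (us @ xs), interp A f (us @ ys)) \<in> ?S\<^sup>+"
    if "list_all2 (\<lambda>x y. (x, y) \<in> ?S\<^sup>+) xs ys" "F f = Some (length (us @ xs))" "set us \<subseteq> carr A"
    for f us xs ys
    using that
  proof (induction arbitrary: us rule: list_all2_induct)
    case Nil
    have "interp A f us \<in> carr A" using A Nil by (auto simp: is_alg_def closed_under_def)
    then show ?case using refl by simp
  next
    case (Cons x xs y ys)
    have xs: "set xs \<subseteq> carr A"
      using Cons(2) sub_trancl by (fastforce simp: list_all2_conv_all_nth in_set_conv_nth)
    have y: "y \<in> carr A" using Cons(1) sub_trancl by blast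
    have "(interp A f (us @ x # xs), interp A f (us @ y # xs)) \<in> ?S\<^sup>+"
      using step[OF Cons(1)] Cons.prems xs by simp
    moreover have "(interp A f (us @ y # xs), interp A f (us @ y # ys)) \<in> ?S\<^sup>+"
      using Cons(3)[of "us @ [y]"] Cons.prems y by simp
    ultimately show ?case by (rule trancl_trans)
  qed
  show "?S\<^sup>+ \<in> Con F A"
  proof (rule Con_I)
    fix x y assume "(x, y) \<in> ?S\<^sup>+"
    moreover have "sym ?S" using Con_D(3)[OF \<alpha>] Con_D(3)[OF \<beta>] by (intro symI) blast
    ultimately show "(y, x) \<in> ?S\<^sup>+" using sym_trancl by (meson symD)
  next
    fix f xs ys
    assume "F f = Some (length xs)" "list_all2 (\<lambda>x y. (x, y) \<in> ?S\<^sup>+) xs ys"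
    then show "(interp A f xs, interp A f ys) \<in> ?S\<^sup>+" using many[of xs ys f "[]"] by simp
  qed (use sub_trancl refl in \<open>auto intro: trancl_trans\<close>)
  show "?S \<subseteq> ?S\<^sup>+" by (auto simp: subset_iff)
qed


section \<open>Term functions and Day terms\<close>

text \<open>The free algebra on countably many generators of the variety generated by \<open>A\<close>. Arguments
  outside the carrier are sent to a fixed element of it.\<close>

definition clamp :: "('f, 'a) alg \<Rightarrow> (nat \<Rightarrow> 'a) \<Rightarrow> nat \<Rightarrow> 'a" where
  "clamp A v i = (if v i \<in> carr A then v i else (SOME a. a \<in> carr A))"

definition term_fun :: "('f, 'a) alg \<Rightarrow> ('f, nat) trm \<Rightarrow> (nat \<Rightarrow> 'a) \<Rightarrow> 'a" where
  "term_fun A t v = eval A (clamp A v) t"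

definition clone_alg :: "'f sig \<Rightarrow> ('f, 'a) alg \<Rightarrow> ('f, (nat \<Rightarrow> 'a) \<Rightarrow> 'a) alg" where
  "clone_alg F A = \<lparr>carr = term_fun A ` {t. wf_trm F t},
     interp = (\<lambda>f ps v. interp A f (map (\<lambda>p. p v) ps))\<rparr>"

lemma range_clamp: "is_alg F A \<Longrightarrow> range (clamp A v) \<subseteq> carr A"
  by (auto simp: clamp_def is_alg_def some_in_eq)

lemma clamp_id: "range v \<subseteq> carr A \<Longrightarrow> clamp A v = v"
  by (auto simp: clamp_def fun_eq_iff)

lemma term_fun_in:
  assumes "is_alg F A" "wf_trm F t" shows "term_fun A t v \<in> carr A"
  using assms eval_in[OF _ range_clamp[OF assms(1)] assms(2)]
  by (auto simp: term_fun_def is_alg_def)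

lemma eval_clone_alg: "eval (clone_alg F A) w t = (\<lambda>v. eval A (\<lambda>i. w i v) t)"
proof (induction t)
  case (App f ts)
  have "interp (clone_alg F A) f (map (eval (clone_alg F A) w) ts) v =
      interp A f (map (eval A (\<lambda>i. w i v)) ts)" for v
    using App by (auto simp: clone_alg_def intro!: arg_cong[where f = "interp A f"])
  then show ?case by auto
qed simp

lemma clone_alg_is_alg: "is_alg F (clone_alg F A)"
proof -
  have "interp (clone_alg F A) f ps \<in> carr (clone_alg F A)"
    if f: "F f = Some (length ps)" and ps: "set ps \<subseteq> carr (clone_alg F A)" for f ps
  proof -
    have "\<exists>ts. (\<forall>t\<in>set ts. wf_trm F t) \<and> map (term_fun A) ts = ps"
      using ps
    proof (induction ps)
      case (Cons p ps)
      then obtain ts t where "\<forall>t\<in>set ts. wf_trm F t" "map (term_fun A) ts = ps"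
          "wf_trm F t" "p = term_fun A t"
        by (auto simp: clone_alg_def)
      then show ?case by (intro exI[of _ "t # ts"]) simp
    qed simp
    then obtain ts where ts: "\<forall>t\<in>set ts. wf_trm F t" "map (term_fun A) ts = ps" by blast
    then have "wf_trm F (App f ts)" using f by auto
    moreover have "interp (clone_alg F A) f ps = term_fun A (App f ts)"
    proof
      fix v
      have "map (\<lambda>p. p v) ps = map (eval A (clamp A v)) ts"
        unfolding ts(2)[symmetric] by (simp add: term_fun_def)
      then show "interp (clone_alg F A) f ps v = term_fun A (App f ts) v"
        by (simp add: clone_alg_def term_fun_def)
    qed
    ultimately show ?thesis by (auto simp: clone_alg_def)
  qed
  moreover have "term_fun A (Var 0) \<in> carr (clone_alg F A)" by (auto simp: clone_alg_def)
  ultimately show ?thesis by (auto simp: is_alg_def closed_under_def)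
qed

text \<open>Identities can be tested pointwise in \<open>v\<close>; clamping keeps all values in the
  carrier, also where \<open>v\<close> leaves it.\<close>

lemma clone_alg_in_models:
  assumes A: "A \<in> models F E" shows "clone_alg F A \<in> models F E"
proof -
  have alg: "is_alg F A" using A by (simp add: models_def)
  have "eval (clone_alg F A) w s = eval (clone_alg F A) w t"
    if st: "(s, t) \<in> E" and w: "range w \<subseteq> carr (clone_alg F A)" for s t w
  proof
    fix v
    have "range (\<lambda>i. w i v) \<subseteq> carr A"
    proof clarify
      fix i
      have "w i \<in> carr (clone_alg F A)" using w by auto
      then show "w i v \<in> carr A" using term_fun_in[OF alg] by (auto simp: clone_alg_def)
    qed
    then show "eval (clone_alg F A) w s v = eval (clone_alg F A) w t v"
      using A st unfolding eval_clone_alg models_def by blast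
  qed
  then show ?thesis using clone_alg_is_alg by (auto simp: models_def)
qed

text \<open>When \<open>A\<close> is an algebra and \<open>V\<close> is cut out by equations between
  coordinates, this is the congruence generated by the corresponding pairs of generators.\<close>

definition agree_on :: "'f sig \<Rightarrow> ('f, 'a) alg \<Rightarrow> (nat \<Rightarrow> 'a) set \<Rightarrow> ((nat \<Rightarrow> 'a) \<Rightarrow> 'a) rel" where
  "agree_on F A V = {(p, q). p \<in> carr (clone_alg F A) \<and> q \<in> carr (clone_alg F A) \<and>
     (\<forall>v\<in>V. range v \<subseteq> carr A \<longrightarrow> p v = q v)}"

lemma agree_on_Con: "agree_on F A V \<in> Con F (clone_alg F A)"
proof (rule Con_I)
  fix f ps qs
  assume f: "F f = Some (length ps)" and l: "list_all2 (\<lambda>p q. (p, q) \<in> agree_on F A V) ps qs"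
  have len: "length qs = length ps" using l by (simp add: list_all2_lengthD)
  have "set ps \<subseteq> carr (clone_alg F A)" "set qs \<subseteq> carr (clone_alg F A)"
    using l by (auto simp: list_all2_conv_all_nth in_set_conv_nth agree_on_def)
  then have "interp (clone_alg F A) f ps \<in> carr (clone_alg F A)"
      "interp (clone_alg F A) f qs \<in> carr (clone_alg F A)"
    using f len clone_alg_is_alg[of F A] by (auto simp: is_alg_def closed_under_def)
  moreover have "map (\<lambda>p. p v) ps = map (\<lambda>p. p v) qs" if "v \<in> V" "range v \<subseteq> carr A" for v
    using that l by (auto intro!: nth_equalityI simp: list_all2_conv_all_nth agree_on_def)
  ultimately show "(interp (clone_alg F A) f ps, interp (clone_alg F A) f qs) \<in> agree_on F A V"
    by (auto simp: agree_on_def clone_alg_def)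
qed (auto simp: agree_on_def)

text \<open>Values for the variables 0 to 3; all later ones repeat \<open>d\<close>, which keeps the
  range in the carrier. It also serves as a substitution, with terms as values.\<close>

definition quad :: "'a \<Rightarrow> 'a \<Rightarrow> 'a \<Rightarrow> 'a \<Rightarrow> nat \<Rightarrow> 'a" where
  "quad a b c d i = (if i = 0 then a else if i = 1 then b else if i = 2 then c else d)"

text \<open>The terms \<open>m(x, y, z, u)\<close> such that \<open>m(x, y, y, x) = x\<close> holds in \<open>A\<close>.\<close>

definition Day_terms :: "'f sig \<Rightarrow> ('f, 'a) alg \<Rightarrow> ('f, nat) trm set" where
  "Day_terms F A = {m. wf_trm F m \<and>
     (\<forall>v. range v \<subseteq> carr A \<longrightarrow> v 0 = v 3 \<longrightarrow> v 1 = v 2 \<longrightarrow> eval A v m = v 0)}"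

text \<open>On the generators \<open>x, y, z, u\<close> of the free algebra, modularity puts \<open>(x, u)\<close> into the join of
  \<open>Cg(y, z)\<close> and \<open>Cg((x, u), (y, z)) \<inter> Cg((x, y), (z, u))\<close>; a chain witnessing this consists of
  Day terms, and is followed below without being named.\<close>

lemma Day_criterion:
  assumes E: "is_identities F E" and cm: "congruence_modular F E" and A: "A \<in> models F E"
    and \<delta>: "\<delta> \<in> Con F A"
    and abcd: "a \<in> carr A" "b \<in> carr A" "c \<in> carr A" "d \<in> carr A" and bd: "(b, d) \<in> \<delta>"
    and m: "\<And>m. m \<in> Day_terms F A \<Longrightarrow> (eval A (quad a b d c) m, eval A (quad a a c c) m) \<in> \<delta>"
  shows "(a, c) \<in> \<delta>"
proof -
  let ?C = "clone_alg F A"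
  have alg: "is_alg F A" using A by (simp add: models_def)
  \<comment> \<open>\<open>\<alpha>\<close>, \<open>\<beta>\<close>, \<open>\<gamma>\<close> are
    Cg((x, u), (y, z)), Cg((x, y), (z, u)) and Cg(y, z).\<close>
  define \<alpha> where "\<alpha> = agree_on F A {v. v 0 = v 3 \<and> v 1 = v 2}"
  define \<beta> where "\<beta> = agree_on F A {v. v 0 = v 1 \<and> v 2 = v 3}"
  define \<gamma> where "\<gamma> = agree_on F A {v. v 1 = v 2}"
  have con: "\<alpha> \<in> Con F ?C" "\<beta> \<in> Con F ?C" "\<gamma> \<in> Con F ?C"
    by (simp_all add: \<alpha>_def \<beta>_def \<gamma>_def agree_on_Con)
  have \<gamma>\<alpha>: "\<gamma> \<subseteq> \<alpha>" by (auto simp: \<alpha>_def \<gamma>_def agree_on_def)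
  define g where "g i = term_fun A (Var i)" for i
  have g: "g i \<in> carr ?C" for i by (auto simp: g_def clone_alg_def)
  have gv: "g i v = v i" if "range v \<subseteq> carr A" for i v
    using that by (simp add: g_def term_fun_def clamp_id)
  have J: "con_join F ?C \<gamma> \<beta> \<in> Con F ?C"
    by (rule con_join_in_Con[OF clone_alg_is_alg con(3,2)])
  have "(g 0, g 1) \<in> \<beta>" "(g 1, g 2) \<in> \<gamma>" "(g 2, g 3) \<in> \<beta>"
    using g by (auto simp: \<beta>_def \<gamma>_def agree_on_def gv)
  then have "(g 0, g 1) \<in> con_join F ?C \<gamma> \<beta>" "(g 1, g 2) \<in> con_join F ?C \<gamma> \<beta>"
      "(g 2, g 3) \<in> con_join F ?C \<gamma> \<beta>"
    using con_join_upper[of \<gamma> \<beta> F ?C] by blast+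
  then have "(g 0, g 3) \<in> con_join F ?C \<gamma> \<beta>" using Con_D(4)[OF J] by blast
  moreover have g03: "(g 0, g 3) \<in> \<alpha>" using g by (auto simp: \<alpha>_def agree_on_def gv)
  moreover have "Con_modular F ?C"
    using congruence_modularD[OF cm E clone_alg_in_models[OF A]] .
  \<comment> \<open>The modular law for \<open>\<gamma> \<subseteq> \<alpha>\<close>, applied to the
    path x, y, z, u through \<open>\<beta>\<close>, \<open>\<gamma>\<close>,
    \<open>\<beta>\<close>.\<close>
  ultimately have "(g 0, g 3) \<in> con_join F ?C \<gamma> (\<beta> \<inter> \<alpha>)"
    using con \<gamma>\<alpha> unfolding Con_modular_def by blast
  then have chain: "(g 0, g 3) \<in> (\<gamma> \<union> (\<beta> \<inter> \<alpha>))\<^sup>+"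
    using con_join_subset_trancl[OF clone_alg_is_alg con(3) Int_Con[OF con(2,1)]] by blast
  \<comment> \<open>A link in \<open>\<beta>\<close> gives equal values at \<open>?u\<close>, one in
    \<open>\<gamma>\<close> at \<open>?w\<close>. The hypothesis on Day terms compares
    \<open>?u\<close> with \<open>?v\<close>, and \<open>(b, d) \<in> \<delta>\<close> compares
    \<open>?v\<close> with \<open>?w\<close>.\<close>
  let ?u = "quad a a c c" and ?v = "quad a b d c" and ?w = "quad a b b c"
  have r: "range ?u \<subseteq> carr A" "range ?v \<subseteq> carr A" "range ?w \<subseteq> carr A"
    using abcd by (auto simp: quad_def)
  have uv: "(p ?v, p ?u) \<in> \<delta>" if p: "(g 0, p) \<in> \<alpha>" for p
  proof -
    obtain t where t: "wf_trm F t" "p = term_fun A t"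
      using p by (auto simp: \<alpha>_def agree_on_def clone_alg_def)
    have "eval A v t = v 0" if "range v \<subseteq> carr A" "v 0 = v 3" "v 1 = v 2" for v
    proof -
      have "p v = g 0 v" using p that by (auto simp: \<alpha>_def agree_on_def)
      then show ?thesis using t(2) gv that(1) by (simp add: term_fun_def clamp_id)
    qed
    then have "t \<in> Day_terms F A" using t(1) by (auto simp: Day_terms_def)
    then show ?thesis using m[of t] r t(2) by (simp add: term_fun_def clamp_id)
  qed
  have vw: "(p ?v, p ?w) \<in> \<delta>" if p: "p \<in> carr ?C" for p
  proof -
    obtain t where t: "wf_trm F t" "p = term_fun A t" using p by (auto simp: clone_alg_def)
    have "(?v x, ?w x) \<in> \<delta>" for x
      using bd abcd Con_D(2,3)[OF \<delta>] by (auto simp: quad_def)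
    then show ?thesis using eval_Con[OF \<delta> _ t(1)] r t(2) by (simp add: term_fun_def clamp_id)
  qed
  \<comment> \<open>Staying in the \<open>\<alpha>\<close>-class of \<open>g 0\<close> is what makes
    every member of the chain a Day term.\<close>
  have walk: "(g 0, q) \<in> \<alpha> \<and> (p ?u, q ?u) \<in> \<delta>"
    if p: "(g 0, p) \<in> \<alpha>" and pq: "(p, q) \<in> \<gamma> \<union> (\<beta> \<inter> \<alpha>)" for p q
  proof -
    have q: "(g 0, q) \<in> \<alpha>" using p pq \<gamma>\<alpha> Con_D(4)[OF con(1)] by blast
    have pC: "p \<in> carr ?C" "q \<in> carr ?C" using p q by (auto simp: \<alpha>_def agree_on_def)
    have "(p ?u, q ?u) \<in> \<delta>"
    proof (cases "(p, q) \<in> \<gamma>")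
      case True
      then have "p ?w = q ?w" using r by (auto simp: \<gamma>_def agree_on_def quad_def)
      then show ?thesis
        using uv[OF p] uv[OF q] vw[OF pC(1)] vw[OF pC(2)] Con_D(3,4)[OF \<delta>] by metis
    next
      case False
      then have "p ?u = q ?u" using pq r by (auto simp: \<beta>_def agree_on_def quad_def)
      then show ?thesis using uv[OF p] Con_D(3,4)[OF \<delta>] by metis
    qed
    then show ?thesis using q by blast
  qed
  have "(g 0, q) \<in> \<alpha> \<and> (g 0 ?u, q ?u) \<in> \<delta>" if "(g 0, q) \<in> (\<gamma> \<union> (\<beta> \<inter> \<alpha>))\<^sup>+" for q
    using that
  proof (induction rule: trancl_induct)
    case (base q)
    then show ?case using walk[of "g 0" q] Con_D(2)[OF con(1) g] by blast
  next
    case (step p q)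
    then show ?case using walk[of p q] Con_D(4)[OF \<delta>] by blast
  qed
  then have "(g 0 ?u, g 3 ?u) \<in> \<delta>" using chain by blast
  then show ?thesis unfolding gv[OF r(1)] by (simp add: quad_def)
qed


section \<open>Centralizing congruences\<close>

text \<open>Applied twice, this gives symmetry and monotonicity in \<open>\<delta>\<close> of the centralizing relation, the
  one place where modularity is needed. The proof feeds \<open>t\<close>-instances into a Day term: moving
  \<open>c\<close> to \<open>d\<close> in the last two arguments turns the trivial equality \<open>m(x, y, y, x) = m(x, x, x, x)\<close>
  into the hypothesis of the Day criterion.\<close>

lemma centralizes_sym:
  fixes A :: "('f, 'a) alg"
  assumes E: "is_identities F E" and cm: "congruence_modular F E" and A: "A \<in> models F E"
    and \<alpha>: "\<alpha> \<subseteq> carr A \<times> carr A" "\<And>x. x \<in> carr A \<Longrightarrow> (x, x) \<in> \<alpha>"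
    and \<beta>: "\<beta> \<subseteq> carr A \<times> carr A" "\<And>x. x \<in> carr A \<Longrightarrow> (x, x) \<in> \<beta>"
    and \<delta>': "\<delta>' \<in> Con F A" and \<delta>: "\<delta> \<in> Con F A" and sub: "\<delta>' \<subseteq> \<delta>"
    and cent: "centralizes F A \<alpha> \<beta> \<delta>'"
  shows "centralizes F A \<beta> \<alpha> \<delta>"
  unfolding centralizes_def
proof (intro allI impI)
  fix t :: "('f, nat + nat) trm" and a b c d :: "nat \<Rightarrow> 'a"
  assume t: "wf_trm F t" and ab: "\<forall>i. (a i, b i) \<in> \<beta>" and cd: "\<forall>j. (c j, d j) \<in> \<alpha>"
    and ad: "(eval A (case_sum a c) t, eval A (case_sum a d) t) \<in> \<delta>"
  have alg: "is_alg F A" using A by (simp add: models_def)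
  have in_carr: "a i \<in> carr A" "b i \<in> carr A" "c i \<in> carr A" "d i \<in> carr A" for i
    using ab cd \<alpha>(1) \<beta>(1) by blast+
  have eval_carr: "eval A (case_sum e g) t \<in> carr A"
    if "\<And>i. e i \<in> carr A" "\<And>i. g i \<in> carr A" for e g
    using alg t that by (intro eval_in[of F]) (auto simp: is_alg_def split: sum.splits)
  let ?bc = "eval A (case_sum b c) t" and ?ac = "eval A (case_sum a c) t"
    and ?bd = "eval A (case_sum b d) t" and ?ad = "eval A (case_sum a d) t"
  have "(eval A (quad ?bc ?ac ?ad ?bd) m, eval A (quad ?bc ?bc ?bd ?bd) m) \<in> \<delta>"
    if m: "m \<in> Day_terms F A" for m
  proof -
    \<comment> \<open>\<open>t\<close> has its \<open>\<beta>\<close>-tuple on the left, while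
      \<open>cent\<close> needs the \<open>\<alpha>\<close>-tuple there, so \<open>\<sigma>\<close>
      swaps the summands. Parity interleaves two tuples: even variables for \<open>b\<close> and
      \<open>c\<close>, odd ones for their replacements.\<close>
    define \<sigma> :: "nat \<Rightarrow> nat \<Rightarrow> nat + nat \<Rightarrow> ('f, nat + nat) trm" where
      "\<sigma> e g = case_sum (\<lambda>j. Var (Inr (2 * j + e))) (\<lambda>i. Var (Inl (2 * i + g)))" for e g
    define T where "T = tsubst (quad (tsubst (\<sigma> 0 0) t) (tsubst (\<sigma> 1 0) t)
      (tsubst (\<sigma> 1 1) t) (tsubst (\<sigma> 0 1) t)) m"
    define mix :: "(nat \<Rightarrow> 'a) \<Rightarrow> (nat \<Rightarrow> 'a) \<Rightarrow> nat \<Rightarrow> 'a" where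
      "mix e g k = (if even k then e (k div 2) else g (k div 2))" for e g k
    have T_wf: "wf_trm F T"
      using m t by (auto simp: T_def Day_terms_def quad_def \<sigma>_def intro!: wf_tsubst split: sum.splits)
    have sub_eval: "eval A (case_sum (mix c e) (mix b g)) (tsubst (\<sigma> x y) t) =
        eval A (case_sum (if x = 0 then b else g) (if y = 0 then c else e)) t"
      if "x \<le> 1" "y \<le> 1" for e g x y
      unfolding eval_tsubst
      using that by (intro arg_cong[where f = "\<lambda>v. eval A v t"])
        (auto simp: \<sigma>_def mix_def fun_eq_iff split: sum.splits)
    have T_eval: "eval A (case_sum (mix c e) (mix b g)) T =
        eval A (quad ?bc (eval A (case_sum g c) t) (eval A (case_sum g e) t)
          (eval A (case_sum b e) t)) m" for e g
      unfolding T_def eval_tsubst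
      by (intro arg_cong[where f = "\<lambda>v. eval A v m"])
        (auto simp: quad_def fun_eq_iff sub_eval)
    have Day: "eval A (quad x y y x) m = x" if "x \<in> carr A" "y \<in> carr A" for x y
    proof -
      have "range (quad x y y x) \<subseteq> carr A" using that by (auto simp: quad_def)
      then have "eval A (quad x y y x) m = quad x y y x 0"
        using m unfolding Day_terms_def by (simp add: quad_def)
      then show ?thesis by (simp add: quad_def)
    qed
    \<comment> \<open>With \<open>c\<close> in both places the four arguments read x, y, y, x, so
      both sides equal \<open>?bc\<close>.\<close>
    have "(eval A (case_sum (mix c c) (mix b a)) T, eval A (case_sum (mix c c) (mix b b)) T) \<in> \<delta>'"
      unfolding T_eval using Day eval_carr in_carr Con_D(2)[OF \<delta>'] by simp
    moreover have "(mix c c i, mix c d i) \<in> \<alpha>" "(mix b a i, mix b b i) \<in> \<beta>" for i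
      using ab cd \<alpha>(2) \<beta>(2) in_carr by (auto simp: mix_def)
    ultimately have
      "(eval A (case_sum (mix c d) (mix b a)) T, eval A (case_sum (mix c d) (mix b b)) T) \<in> \<delta>'"
      using cent T_wf unfolding centralizes_def by blast
    then show ?thesis unfolding T_eval using sub by blast
  qed
  \<comment> \<open>The assumption \<open>ad\<close>, that is
    \<open>(?ac, ?ad) \<in> \<delta>\<close>, supplies the middle pair of the criterion.\<close>
  then show "(?bc, ?bd) \<in> \<delta>"
    using Day_criterion[OF E cm A \<delta>, of ?bc ?ac ?bd ?ad] ad eval_carr in_carr by blast
qed

text \<open>The congruence found is the largest one centralizing \<open>\<beta>\<close> modulo \<open>\<delta>\<close>.\<close>

lemma centralizes_congruence:
  fixes A :: "('f, 'a) alg"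
  assumes alg: "is_alg F A"
    and \<alpha>: "\<alpha> \<subseteq> carr A \<times> carr A" "\<And>x. x \<in> carr A \<Longrightarrow> (x, x) \<in> \<alpha>"
      "\<And>x y. (x, y) \<in> \<alpha> \<Longrightarrow> (y, x) \<in> \<alpha>"
    and cent: "centralizes F A \<alpha> \<beta> \<delta>"
  obtains \<theta> where "\<theta> \<in> Con F A" "\<alpha> \<subseteq> \<theta>" "centralizes F A \<theta> \<beta> \<delta>"
proof -
  define P :: "('f, nat + nat) trm \<Rightarrow> (nat \<Rightarrow> 'a) \<Rightarrow> (nat \<Rightarrow> 'a) \<Rightarrow> (nat \<Rightarrow> 'a) \<Rightarrow> bool" where
    "P t a c d \<longleftrightarrow> (eval A (case_sum a c) t, eval A (case_sum a d) t) \<in> \<delta>" for t a c d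
  \<comment> \<open>Invariance under exchanging \<open>x\<close> and \<open>y\<close> in a single
    left coordinate. Asking for equal truth values, not for an implication, makes this symmetric and
    transitive.\<close>
  define \<theta> where "\<theta> = {(x, y). x \<in> carr A \<and> y \<in> carr A \<and>
    (\<forall>t v i c d. wf_trm F t \<longrightarrow> range v \<subseteq> carr A \<longrightarrow> (\<forall>j. (c j, d j) \<in> \<beta>) \<longrightarrow>
       P t (v(i := x)) c d = P t (v(i := y)) c d)}"
  have \<theta>D: "P t (v(i := x)) c d = P t (v(i := y)) c d"
    if "(x, y) \<in> \<theta>" "wf_trm F t" "range v \<subseteq> carr A" "\<forall>j. (c j, d j) \<in> \<beta>" for x y t v i c d
    using that unfolding \<theta>_def by blast
  \<comment> \<open>From one coordinate to whole tuples: coordinates are exchanged one at a time,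
    and only the finitely many occurring in \<open>t\<close> matter.\<close>
  have all: "P t a c d = P t b c d"
    if t: "wf_trm F t" and ab: "\<And>i. (a i, b i) \<in> \<theta>" and cd: "\<forall>j. (c j, d j) \<in> \<beta>" for t a b c d
  proof -
    have carr: "a i \<in> carr A" "b i \<in> carr A" for i using ab by (auto simp: \<theta>_def)
    have fin: "P t a c d = P t (override_on a b S) c d" if "finite S" for S
      using that
    proof (induction S)
      case (insert i S)
      let ?o = "override_on a b S"
      have "override_on a b (insert i S) = ?o(i := b i)" by (simp add: override_on_insert)
      moreover have "?o(i := a i) = ?o" using insert(2) by (auto simp: override_on_def)
      moreover have "range ?o \<subseteq> carr A" using carr by (auto simp: override_on_def)
      ultimately show ?case using \<theta>D[OF ab t _ cd, of ?o i i] insert(3) by metis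
    qed simp
    define S where "S = Inl -` set2_trm t"
    have "finite S" unfolding S_def by (intro finite_vimageI finite_vars) simp
    moreover have "eval A (case_sum (override_on a b S) e) t = eval A (case_sum b e) t" for e
      by (intro eval_cong_vars) (auto simp: S_def override_on_def split: sum.splits)
    ultimately show ?thesis using fin[of S] by (simp add: P_def)
  qed
  have "\<theta> \<in> Con F A"
  proof (rule Con_I)
    fix f xs ys
    assume f: "F f = Some (length xs)" and l: "list_all2 (\<lambda>x y. (x, y) \<in> \<theta>) xs ys"
    let ?n = "length xs"
    have len: "length ys = ?n" using l by (simp add: list_all2_lengthD)
    have nth: "(xs ! i, ys ! i) \<in> \<theta>" if "i < ?n" for i using l that by (simp add: list_all2_conv_all_nth)
    have "set xs \<subseteq> carr A" "set ys \<subseteq> carr A"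
      using l by (auto simp: list_all2_conv_all_nth in_set_conv_nth \<theta>_def)
    then have carr: "interp A f xs \<in> carr A" "interp A f ys \<in> carr A"
      using alg f len by (auto simp: is_alg_def closed_under_def)
    have "P t (v(i := interp A f xs)) c d = P t (v(i := interp A f ys)) c d"
      if t: "wf_trm F t" and v: "range v \<subseteq> carr A" and cd: "\<forall>j. (c j, d j) \<in> \<beta>" for t v i c d
    proof -
      \<comment> \<open>An \<open>f\<close>-term is substituted for variable \<open>i\<close>. Its
        arguments take the first \<open>?n\<close> variables and the old ones shift up by
        \<open>?n\<close>, so that \<open>w\<close> is \<open>zs\<close> followed by
        \<open>v\<close>.\<close>
      define \<sigma> :: "nat + nat \<Rightarrow> ('f, nat + nat) trm" where
        "\<sigma> = case_sum (\<lambda>k. if k = i then App f (map (\<lambda>j. Var (Inl j)) [0..<?n]) else Var (Inl (k + ?n)))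
          (\<lambda>j. Var (Inr j))"
      define w where "w zs k = (if k < ?n then zs ! k else v (k - ?n))" for zs k
      have args: "map (\<lambda>j. w zs j) [0..<?n] = zs" if "length zs = ?n" for zs
        using that by (auto simp: w_def intro: nth_equalityI)
      have "eval A (case_sum (w zs) e) (tsubst \<sigma> t) = eval A (case_sum (v(i := interp A f zs)) e) t"
        if "length zs = ?n" for zs e
        unfolding eval_tsubst
        by (intro arg_cong[where f = "\<lambda>v. eval A v t"])
          (auto simp: \<sigma>_def fun_eq_iff comp_def args[OF that] w_def[of zs "_ + ?n"] split: sum.splits)
      then have P: "P (tsubst \<sigma> t) (w zs) c d = P t (v(i := interp A f zs)) c d"
        if "length zs = ?n" for zs
        using that by (simp add: P_def)
      have "wf_trm F (\<sigma> x)" for x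
        using f by (auto simp: \<sigma>_def split: sum.splits)
      moreover have "(w xs k, w ys k) \<in> \<theta>" for k
        using nth v by (auto simp: w_def \<theta>_def)
      ultimately show ?thesis
        using all[OF wf_tsubst[OF t], of \<sigma> "w xs" "w ys" c d] cd P[of xs] P[of ys] len by simp
    qed
    then show "(interp A f xs, interp A f ys) \<in> \<theta>" using carr by (auto simp: \<theta>_def)
  qed (auto simp: \<theta>_def)
  moreover have "\<alpha> \<subseteq> \<theta>"
  proof (rule subrelI)
    fix x y assume xy: "(x, y) \<in> \<alpha>"
    \<comment> \<open>Centralizing yields one direction only; symmetry of \<open>\<alpha>\<close>
      gives the converse.\<close>
    have imp: "P t (v(i := x)) c d \<longrightarrow> P t (v(i := y)) c d"
      if "(x, y) \<in> \<alpha>" "wf_trm F t" "range v \<subseteq> carr A" "\<forall>j. (c j, d j) \<in> \<beta>" for x y t v i c d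
    proof -
      have "\<forall>k. ((v(i := x)) k, (v(i := y)) k) \<in> \<alpha>" using that(1,3) \<alpha>(2) by auto
      then show ?thesis using cent that(2,4) unfolding centralizes_def P_def by blast
    qed
    then have "P t (v(i := x)) c d = P t (v(i := y)) c d"
      if "wf_trm F t" "range v \<subseteq> carr A" "\<forall>j. (c j, d j) \<in> \<beta>" for t v i c d
      using that xy \<alpha>(3)[OF xy] by blast
    then show "(x, y) \<in> \<theta>" using xy \<alpha>(1) by (auto simp: \<theta>_def)
  qed
  moreover have "centralizes F A \<theta> \<beta> \<delta>"
    using all unfolding centralizes_def P_def by blast
  ultimately show ?thesis using that by blast
qed


section \<open>Surjective morphisms\<close>

definition img :: "('a \<Rightarrow> 'b) \<Rightarrow> 'a rel \<Rightarrow> 'b rel" where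
  "img h \<alpha> = {(h x, h y) | x y. (x, y) \<in> \<alpha>}"

text \<open>The image of a congruence can fail to be transitive; these three properties are all that
  the lemmas on centralizing ask of it.\<close>

lemma img_relation:
  assumes \<alpha>: "\<alpha> \<in> Con F M" and h: "h ` carr M = carr N"
  shows "img h \<alpha> \<subseteq> carr N \<times> carr N" "x \<in> carr N \<Longrightarrow> (x, x) \<in> img h \<alpha>"
    "(x, y) \<in> img h \<alpha> \<Longrightarrow> (y, x) \<in> img h \<alpha>"
  using Con_D(1-3)[OF \<alpha>] unfolding img_def h[symmetric] by blast+

lemma Ker_subset_pullback:
  assumes "\<psi> \<in> Con F N" shows "Ker M N h \<subseteq> pullback M h \<psi>"
  using Con_D(2)[OF assms] by (auto simp: Ker_def pullback_def)

text \<open>Two preimages of one element differ by a pair of the kernel, so the choice of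
  representatives does not matter.\<close>

lemma in_con_of_img:
  assumes \<alpha>: "\<alpha> \<in> Con F M" and h: "h ` carr M \<subseteq> carr N" and K: "Ker M N h \<subseteq> \<alpha>"
    and xy: "x \<in> carr M" "y \<in> carr M" "(h x, h y) \<in> img h \<alpha>"
  shows "(x, y) \<in> \<alpha>"
proof -
  obtain x' y' where *: "(x', y') \<in> \<alpha>" "h x = h x'" "h y = h y'" using xy(3) by (auto simp: img_def)
  then have "x' \<in> carr M" "y' \<in> carr M" using Con_D(1)[OF \<alpha>] by blast+
  moreover have "(u, v) \<in> \<alpha>" if "u \<in> carr M" "v \<in> carr M" "h u = h v" for u v
  proof -
    have "(u, v) \<in> Ker M N h" using h that by (auto simp: Ker_def pullback_def)
    then show ?thesis using K by blast
  qed
  ultimately have "(x, x') \<in> \<alpha>" "(y', y) \<in> \<alpha>" using xy(1,2) *(2,3) by metis+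
  then show ?thesis using *(1) Con_D(4)[OF \<alpha>] by blast
qed

lemma pullback_img:
  assumes "\<alpha> \<in> Con F M" "h ` carr M \<subseteq> carr N" "Ker M N h \<subseteq> \<alpha>"
  shows "pullback M h (img h \<alpha>) = \<alpha>"
  using in_con_of_img[OF assms] Con_D(1)[OF assms(1)] by (auto simp: pullback_def img_def)

text \<open>As \<open>\<alpha>\<close> contains the kernel, pairs of the image lift to any chosen
  preimages; consecutive pairs can then share the middle one, which gives transitivity.\<close>

lemma img_Con:
  assumes \<alpha>: "\<alpha> \<in> Con F M" and mor: "morphism F M N h" and h: "h ` carr M = carr N"
    and K: "Ker M N h \<subseteq> \<alpha>"
  shows "img h \<alpha> \<in> Con F N"
proof (rule Con_I)
  have inD: "(x, y) \<in> \<alpha>" if "x \<in> carr M" "y \<in> carr M" "(h x, h y) \<in> img h \<alpha>" for x y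
    using in_con_of_img[OF \<alpha> _ K that] h by simp
  show "(x, z) \<in> img h \<alpha>" if xy: "(x, y) \<in> img h \<alpha>" and yz: "(y, z) \<in> img h \<alpha>" for x y z
  proof -
    have "x \<in> h ` carr M" "y \<in> h ` carr M" "z \<in> h ` carr M"
      using xy yz img_relation(1)[OF \<alpha> h] h by auto
    then obtain a b c where *: "a \<in> carr M" "b \<in> carr M" "c \<in> carr M" "x = h a" "y = h b" "z = h c"
      by blast
    then have "(a, b) \<in> \<alpha>" "(b, c) \<in> \<alpha>" using inD xy yz by auto
    then have "(a, c) \<in> \<alpha>" by (rule Con_D(4)[OF \<alpha>])
    then show ?thesis using * by (auto simp: img_def)
  qed
  show "(interp N f xs, interp N f ys) \<in> img h \<alpha>"
    if f: "F f = Some (length xs)" and l: "list_all2 (\<lambda>x y. (x, y) \<in> img h \<alpha>) xs ys" for f xs ys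
  proof -
    have "\<exists>us vs. list_all2 (\<lambda>x y. (x, y) \<in> \<alpha>) us vs \<and> map h us = xs \<and> map h vs = ys"
      using l
    proof (induction rule: list_all2_induct)
      case (Cons x xs y ys)
      then obtain us vs u v where "list_all2 (\<lambda>x y. (x, y) \<in> \<alpha>) us vs" "map h us = xs" "map h vs = ys"
          "(u, v) \<in> \<alpha>" "x = h u" "y = h v"
        by (auto simp: img_def)
      then show ?case by (intro exI[of _ "u # us"] exI[of _ "v # vs"]) simp
    qed simp
    then obtain us vs where *: "list_all2 (\<lambda>x y. (x, y) \<in> \<alpha>) us vs" "map h us = xs" "map h vs = ys"
      by blast
    have sub: "set us \<subseteq> carr M" "set vs \<subseteq> carr M"
      using *(1) Con_D(1)[OF \<alpha>] by (fastforce simp: list_all2_conv_all_nth in_set_conv_nth)+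
    have len: "F f = Some (length us)" "F f = Some (length vs)"
      using f * list_all2_lengthD[OF *(1)] by auto
    have "h (interp M f us) = interp N f xs" "h (interp M f vs) = interp N f ys"
      using mor sub len * unfolding morphism_def by blast+
    then show ?thesis using Con_D(5)[OF \<alpha> len(1) *(1)] unfolding img_def by force
  qed
qed (use img_relation[OF \<alpha> h] in auto)

lemma pullback_eq_nabla:
  assumes \<psi>: "\<psi> \<in> Con F N" and h: "h ` carr M = carr N"
  shows "pullback M h \<psi> = nabla M \<longleftrightarrow> \<psi> = nabla N"
proof -
  have "pullback M h \<psi> = nabla M \<longleftrightarrow> (\<forall>x\<in>carr M. \<forall>y\<in>carr M. (h x, h y) \<in> \<psi>)"
    by (auto simp: pullback_def nabla_def)
  also have "\<dots> \<longleftrightarrow> (\<forall>x\<in>carr N. \<forall>y\<in>carr N. (x, y) \<in> \<psi>)" by (simp flip: h)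
  also have "\<dots> \<longleftrightarrow> \<psi> = nabla N" using Con_D(1)[OF \<psi>] by (auto simp: nabla_def)
  finally show ?thesis .
qed

section \<open>Centralizing along a morphism\<close>

lemma eval_case_sum_morphism:
  assumes "morphism F M N h" "is_alg F M" "wf_trm F t" "\<And>i. a i \<in> carr M" "\<And>j. c j \<in> carr M"
  shows "h (eval M (case_sum a c) t) = eval N (case_sum (\<lambda>i. h (a i)) (\<lambda>j. h (c j))) t"
proof -
  have "h (eval M (case_sum a c) t) = eval N (\<lambda>x. h (case_sum a c x)) t"
    using assms by (intro morphism_eval) (auto split: sum.splits)
  also have "(\<lambda>x. h (case_sum a c x)) = case_sum (\<lambda>i. h (a i)) (\<lambda>j. h (c j))"
    by (auto simp: fun_eq_iff split: sum.splits)
  finally show ?thesis .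
qed

lemma centralizes_img:
  fixes M :: "('f, 'a) alg" and N :: "('f, 'b) alg"
  assumes M: "is_alg F M" and mor: "morphism F M N h"
    and \<alpha>: "\<alpha> \<in> Con F M" and \<beta>: "\<beta> \<in> Con F M"
    and cent: "centralizes F M \<alpha> \<beta> (pullback M h \<psi>)"
  shows "centralizes F N (img h \<alpha>) (img h \<beta>) \<psi>"
  unfolding centralizes_def
proof (intro allI impI)
  fix t :: "('f, nat + nat) trm" and a b c d
  assume t: "wf_trm F t" and ab: "\<forall>i. (a i, b i) \<in> img h \<alpha>" and cd: "\<forall>j. (c j, d j) \<in> img h \<beta>"
    and eq: "(eval N (case_sum a c) t, eval N (case_sum a d) t) \<in> \<psi>"
  have "\<forall>i. \<exists>x y. (x, y) \<in> \<alpha> \<and> a i = h x \<and> b i = h y" using ab by (fastforce simp: img_def)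
  then obtain a' b' where a': "\<And>i. (a' i, b' i) \<in> \<alpha>" "a = (\<lambda>i. h (a' i))" "b = (\<lambda>i. h (b' i))"
    by (metis ext)
  have "\<forall>i. \<exists>x y. (x, y) \<in> \<beta> \<and> c i = h x \<and> d i = h y" using cd by (fastforce simp: img_def)
  then obtain c' d' where c': "\<And>i. (c' i, d' i) \<in> \<beta>" "c = (\<lambda>i. h (c' i))" "d = (\<lambda>i. h (d' i))"
    by (metis ext)
  have carr: "a' i \<in> carr M" "b' i \<in> carr M" "c' i \<in> carr M" "d' i \<in> carr M" for i
    using a'(1) c'(1) Con_D(1)[OF \<alpha>] Con_D(1)[OF \<beta>] by blast+
  have ev: "eval M (case_sum e g) t \<in> carr M"
    if "\<And>i. e i \<in> carr M" "\<And>i. g i \<in> carr M" for e g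
    using M t that by (intro eval_in[of F]) (auto simp: is_alg_def split: sum.splits)
  note hom = eval_case_sum_morphism[OF mor M t]
  have "(eval M (case_sum a' c') t, eval M (case_sum a' d') t) \<in> pullback M h \<psi>"
    using eq carr ev by (simp add: pullback_def hom a' c')
  then have "(eval M (case_sum b' c') t, eval M (case_sum b' d') t) \<in> pullback M h \<psi>"
    using cent t a'(1) c'(1) unfolding centralizes_def by blast
  then show "(eval N (case_sum b c) t, eval N (case_sum b d) t) \<in> \<psi>"
    using carr by (simp add: pullback_def hom a' c')
qed

text \<open>With \<open>\<psi>\<close> the commutator of \<open>\<alpha>\<close> and
  \<open>\<beta>\<close>, this bounds the commutator of the pullbacks by the pullback of the
  commutator.\<close>

lemma centralizes_pullback:
  fixes M :: "('f, 'a) alg" and N :: "('f, 'b) alg"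
  assumes M: "is_alg F M" and mor: "morphism F M N h"
    and cent: "centralizes F N \<alpha> \<beta> \<psi>"
  shows "centralizes F M (pullback M h \<alpha>) (pullback M h \<beta>) (pullback M h \<psi>)"
  unfolding centralizes_def
proof (intro allI impI)
  fix t :: "('f, nat + nat) trm" and a b c d
  assume t: "wf_trm F t" and ab: "\<forall>i. (a i, b i) \<in> pullback M h \<alpha>"
    and cd: "\<forall>j. (c j, d j) \<in> pullback M h \<beta>"
    and eq: "(eval M (case_sum a c) t, eval M (case_sum a d) t) \<in> pullback M h \<psi>"
  have carr: "a i \<in> carr M" "b i \<in> carr M" "c i \<in> carr M" "d i \<in> carr M" for i
    using ab cd by (auto simp: pullback_def)
  have ev: "eval M (case_sum e g) t \<in> carr M"
    if "\<And>i. e i \<in> carr M" "\<And>i. g i \<in> carr M" for e g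
    using M t that by (intro eval_in[of F]) (auto simp: is_alg_def split: sum.splits)
  note hom = eval_case_sum_morphism[OF mor M t]
  have "(h (a i), h (b i)) \<in> \<alpha>" "(h (c i), h (d i)) \<in> \<beta>" for i
    using ab cd by (auto simp: pullback_def)
  moreover have "(eval N (case_sum (\<lambda>i. h (a i)) (\<lambda>j. h (c j))) t,
      eval N (case_sum (\<lambda>i. h (a i)) (\<lambda>j. h (d j))) t) \<in> \<psi>"
    using eq carr by (simp add: pullback_def hom)
  ultimately have "(eval N (case_sum (\<lambda>i. h (b i)) (\<lambda>j. h (c j))) t,
      eval N (case_sum (\<lambda>i. h (b i)) (\<lambda>j. h (d j))) t) \<in> \<psi>"
    using cent t unfolding centralizes_def by metis
  then show "(eval M (case_sum b c) t, eval M (case_sum b d) t) \<in> pullback M h \<psi>"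
    using carr ev by (simp add: pullback_def hom)
qed

section \<open>Prime congruences along a surjective morphism\<close>

lemma surjective_admissible:
  fixes M :: "('f, 'a) alg" and N :: "('f, 'b) alg"
  assumes E: "is_identities F E" and cm: "congruence_modular F E"
    and M: "M \<in> models F E" and N: "N \<in> models F E"
    and mor: "morphism F M N h" and h: "h ` carr M = carr N"
  shows "admissible F M N h"
  unfolding admissible_def
proof
  fix \<psi> assume \<psi>: "\<psi> \<in> Spec F N"
  let ?\<phi> = "pullback M h \<psi>"
  have algM: "is_alg F M" and algN: "is_alg F N" using M N by (simp_all add: models_def)
  have \<psi>C: "\<psi> \<in> Con F N" and \<psi>n: "\<psi> \<noteq> nabla N" using \<psi> by (simp_all add: Spec_def)
  have \<phi>C: "?\<phi> \<in> Con F M" using pullback_in_Con[OF algM mor \<psi>C] .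
  have "\<alpha> \<subseteq> ?\<phi> \<or> \<beta> \<subseteq> ?\<phi>"
    if \<alpha>: "\<alpha> \<in> Con F M" and \<beta>: "\<beta> \<in> Con F M" and com: "commutator F M \<alpha> \<beta> \<subseteq> ?\<phi>" for \<alpha> \<beta>
  proof -
    note comC = commutator_least(1)[OF algM \<alpha> \<beta>]
    \<comment> \<open>The first swap passes from the commutator up to \<open>?\<phi>\<close>; the
      second, at \<open>?\<phi>\<close>, restores the order.\<close>
    have "centralizes F M \<beta> \<alpha> ?\<phi>"
      using centralizes_sym[OF E cm M Con_D(1,2)[OF \<alpha>] Con_D(1,2)[OF \<beta>] comC \<phi>C com
          commutator_least(2)[OF algM \<alpha> \<beta>]] .
    then have "centralizes F M \<alpha> \<beta> ?\<phi>"
      using centralizes_sym[OF E cm M Con_D(1,2)[OF \<beta>] Con_D(1,2)[OF \<alpha>] \<phi>C \<phi>C] by blast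
    then have "centralizes F N (img h \<alpha>) (img h \<beta>) \<psi>"
      by (rule centralizes_img[OF algM mor \<alpha> \<beta>])
    then obtain \<alpha>' where \<alpha>': "\<alpha>' \<in> Con F N" "img h \<alpha> \<subseteq> \<alpha>'" "centralizes F N \<alpha>' (img h \<beta>) \<psi>"
      using centralizes_congruence[OF algN img_relation[OF \<alpha> h]] by blast
    \<comment> \<open>\<open>centralizes_congruence\<close> enlarges only the left argument, so the
      two are exchanged first.\<close>
    have "centralizes F N (img h \<beta>) \<alpha>' \<psi>"
      using centralizes_sym[OF E cm N Con_D(1,2)[OF \<alpha>'(1)] img_relation(1,2)[OF \<beta> h] \<psi>C \<psi>C _ \<alpha>'(3)]
      by blast
    then obtain \<beta>' where \<beta>': "\<beta>' \<in> Con F N" "img h \<beta> \<subseteq> \<beta>'" "centralizes F N \<beta>' \<alpha>' \<psi>"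
      using centralizes_congruence[OF algN img_relation[OF \<beta> h]] by blast
    have "commutator F N \<beta>' \<alpha>' \<subseteq> \<psi>"
      using commutator_least(3)[OF algN \<beta>'(1) \<alpha>'(1) \<psi>C \<beta>'(3)] .
    then have "\<beta>' \<subseteq> \<psi> \<or> \<alpha>' \<subseteq> \<psi>" using \<psi> \<alpha>'(1) \<beta>'(1) by (simp add: Spec_def)
    then have "img h \<beta> \<subseteq> \<psi> \<or> img h \<alpha> \<subseteq> \<psi>" using \<alpha>'(2) \<beta>'(2) by blast
    then show ?thesis
      using Con_D(1)[OF \<alpha>] Con_D(1)[OF \<beta>] by (fastforce simp: pullback_def img_def)
  qed
  then show "?\<phi> \<in> Spec F M"
    using \<phi>C pullback_eq_nabla[OF \<psi>C h] \<psi>n by (simp add: Spec_def)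
qed

text \<open>Primeness of \<open>\<phi>\<close> applies to the pullbacks, whose commutator lies in
  the pullback of the commutator; surjectivity carries the resulting inclusion back to
  \<open>N\<close>.\<close>

lemma img_Spec:
  assumes M: "is_alg F M" and N: "is_alg F N" and mor: "morphism F M N h"
    and h: "h ` carr M = carr N" and \<phi>: "\<phi> \<in> Spec F M" and K: "Ker M N h \<subseteq> \<phi>"
  shows "img h \<phi> \<in> Spec F N"
proof -
  have \<phi>C: "\<phi> \<in> Con F M" using \<phi> by (simp add: Spec_def)
  have C: "img h \<phi> \<in> Con F N" by (rule img_Con[OF \<phi>C mor h K])
  have pb: "pullback M h (img h \<phi>) = \<phi>" using pullback_img[OF \<phi>C _ K] h by simp
  have "\<alpha> \<subseteq> img h \<phi> \<or> \<beta> \<subseteq> img h \<phi>"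
    if \<alpha>: "\<alpha> \<in> Con F N" and \<beta>: "\<beta> \<in> Con F N" and com: "commutator F N \<alpha> \<beta> \<subseteq> img h \<phi>" for \<alpha> \<beta>
  proof -
    note pbC = pullback_in_Con[OF M mor]
    have "commutator F M (pullback M h \<alpha>) (pullback M h \<beta>) \<subseteq> pullback M h (commutator F N \<alpha> \<beta>)"
      using commutator_least(3)[OF M pbC[OF \<alpha>] pbC[OF \<beta>] pbC[OF commutator_least(1)[OF N \<alpha> \<beta>]]
          centralizes_pullback[OF M mor commutator_least(2)[OF N \<alpha> \<beta>]]] .
    also have "\<dots> \<subseteq> pullback M h (img h \<phi>)" using com by (auto simp: pullback_def)
    also note pb
    finally have "pullback M h \<alpha> \<subseteq> \<phi> \<or> pullback M h \<beta> \<subseteq> \<phi>"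
      using \<phi> pbC[OF \<alpha>] pbC[OF \<beta>] by (simp add: Spec_def)
    moreover have "\<gamma> \<subseteq> img h \<phi>" if \<gamma>: "\<gamma> \<in> Con F N" and "pullback M h \<gamma> \<subseteq> \<phi>" for \<gamma>
    proof (rule subrelI)
      fix x y assume xy: "(x, y) \<in> \<gamma>"
      then have "x \<in> h ` carr M" "y \<in> h ` carr M" using Con_D(1)[OF \<gamma>] h by auto
      then show "(x, y) \<in> img h \<phi>" using xy that(2) by (auto simp: pullback_def img_def)
    qed
    ultimately show ?thesis using \<alpha> \<beta> by blast
  qed
  moreover have "img h \<phi> \<noteq> nabla N"
    using \<phi> pb pullback_eq_nabla[OF C h] by (simp add: Spec_def)
  ultimately show ?thesis using C by (simp add: Spec_def)
qed

lemma surjective_LO: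
  assumes "is_alg F M" "is_alg F N" "morphism F M N h" "h ` carr M = carr N"
  shows "LO F M N h"
  unfolding LO_def
proof (intro ballI impI)
  fix \<phi> assume \<phi>: "\<phi> \<in> Spec F M" "Ker M N h \<subseteq> \<phi>"
  then have "pullback M h (img h \<phi>) = \<phi>" using assms(4) by (intro pullback_img) (auto simp: Spec_def)
  then show "\<exists>\<phi>\<^sub>1\<in>Spec F N. pullback M h \<phi>\<^sub>1 = \<phi>" using img_Spec[OF assms \<phi>] by blast
qed

lemma surjective_GU:
  assumes "is_alg F M" "is_alg F N" "morphism F M N h" and h: "h ` carr M = carr N"
  shows "GU F M N h"
  unfolding GU_def
proof (intro ballI impI)
  fix \<phi> \<psi> \<phi>\<^sub>1
  assume \<psi>: "\<psi> \<in> Spec F M" and \<phi>\<^sub>1: "\<phi>\<^sub>1 \<in> Spec F N" and sub: "\<phi> \<subseteq> \<psi>" and pb: "pullback M h \<phi>\<^sub>1 = \<phi>"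
  have \<phi>\<^sub>1C: "\<phi>\<^sub>1 \<in> Con F N" using \<phi>\<^sub>1 by (simp add: Spec_def)
  \<comment> \<open>\<open>\<phi>\<close> is a pullback and so contains the kernel; hence so does
    \<open>\<psi>\<close>, whose image is the required prime.\<close>
  have K: "Ker M N h \<subseteq> \<psi>" using Ker_subset_pullback[OF \<phi>\<^sub>1C, of M h] pb sub by blast
  have "\<phi>\<^sub>1 \<subseteq> img h \<psi>"
  proof (rule subrelI)
    fix x y assume xy: "(x, y) \<in> \<phi>\<^sub>1"
    then have "x \<in> h ` carr M" "y \<in> h ` carr M" using Con_D(1)[OF \<phi>\<^sub>1C] h by auto
    then show "(x, y) \<in> img h \<psi>" using xy sub unfolding pb[symmetric] by (auto simp: pullback_def img_def)
  qed
  moreover have "pullback M h (img h \<psi>) = \<psi>"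
    using h \<psi> K by (intro pullback_img) (auto simp: Spec_def)
  ultimately show "\<exists>\<psi>\<^sub>1\<in>Spec F N. \<phi>\<^sub>1 \<subseteq> \<psi>\<^sub>1 \<and> pullback M h \<psi>\<^sub>1 = \<psi>"
    using img_Spec[OF assms \<psi> K] by blast
qed


section \<open>Bounded majority algebras\<close>

text \<open>Symbol 0 is the majority operation; symbols 1 and 2 are the constants 0 and 1 of the
  identity m(0, x, 1) = x.\<close>

definition maj_sig :: "nat sig" where
  "maj_sig = [0 \<mapsto> 3, 1 \<mapsto> 0, 2 \<mapsto> 0]"

abbreviation maj :: "(nat, 'v) trm \<Rightarrow> (nat, 'v) trm \<Rightarrow> (nat, 'v) trm \<Rightarrow> (nat, 'v) trm" where
  "maj r s t \<equiv> App 0 [r, s, t]"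

definition maj_ids :: "nat identities" where
  "maj_ids = (let x = Var 0; y = Var 1 in
     {(maj x x y, x), (maj x y x, x), (maj y x x, x), (maj (App 1 []) x (App 2 []), x)})"

lemma maj_is_identities: "is_identities maj_sig maj_ids"
  by (auto simp: is_identities_def maj_ids_def maj_sig_def Let_def)

lemma maj_models_iff:
  fixes A :: "(nat, 'a) alg"
  shows
  "A \<in> models maj_sig maj_ids \<longleftrightarrow> is_alg maj_sig A \<and> (\<forall>x\<in>carr A. \<forall>y\<in>carr A.
     interp A 0 [x, x, y] = x \<and> interp A 0 [x, y, x] = x \<and> interp A 0 [y, x, x] = x \<and>
     interp A 0 [interp A 1 [], x, interp A 2 []] = x)" (is "_ \<longleftrightarrow> _ \<and> ?R")
proof -
  have "(\<forall>(s, t)\<in>maj_ids. \<forall>v. range v \<subseteq> carr A \<longrightarrow> eval A v s = eval A v t) \<longleftrightarrow> ?R"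
    (is "?L \<longleftrightarrow> _")
  proof
    assume ?L
    show ?R
    proof (intro ballI)
      fix x y assume "x \<in> carr A" "y \<in> carr A"
      then have "range (\<lambda>i::nat. if i = 0 then x else y) \<subseteq> carr A" by auto
      with \<open>?L\<close> have "\<forall>(s, t)\<in>maj_ids. eval A (\<lambda>i. if i = 0 then x else y) s =
          eval A (\<lambda>i. if i = 0 then x else y) t"
        by blast
      then show "interp A 0 [x, x, y] = x \<and> interp A 0 [x, y, x] = x \<and>
          interp A 0 [y, x, x] = x \<and> interp A 0 [interp A 1 [], x, interp A 2 []] = x"
        by (simp add: maj_ids_def Let_def)
    qed
  next
    assume R: ?R
    have "v 0 \<in> carr A" "v 1 \<in> carr A" if "range v \<subseteq> carr A" for v :: "nat \<Rightarrow> 'a"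
      using that by auto
    moreover have "interp A 0 [interp A 1 [], x, interp A 2 []] = x" if "x \<in> carr A" for x
      using R that by blast
    ultimately show ?L using R by (simp add: maj_ids_def Let_def)
  qed
  then show ?thesis by (simp add: models_def)
qed

lemma maj_Con:
  assumes "\<theta> \<in> Con maj_sig A" "(x, x') \<in> \<theta>" "(y, y') \<in> \<theta>" "(z, z') \<in> \<theta>"
  shows "(interp A 0 [x, y, z], interp A 0 [x', y', z']) \<in> \<theta>"
  using assms by (intro Con_D(5)[OF assms(1)]) (auto simp: maj_sig_def)

text \<open>Apply m(x, y, -) to a chain from x to y in \<open>\<beta> \<union> \<gamma>\<close>. Its
  ends stay x and y by majority, and each m(x, y, z) is \<open>\<alpha>\<close>-related to m(x, x,
  z) = x, so all links of the new chain lie in \<open>\<alpha>\<close>.\<close>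

lemma maj_congruence_distributive: "congruence_distributive maj_sig maj_ids"
  unfolding congruence_distributive_def Con_distributive_def
proof (intro allI impI ballI equalityI)
  fix A :: "(nat, (nat, nat) trm) alg" and \<alpha> \<beta> \<gamma>
  assume A: "A \<in> models maj_sig maj_ids"
    and con: "\<alpha> \<in> Con maj_sig A" "\<beta> \<in> Con maj_sig A" "\<gamma> \<in> Con maj_sig A"
  have alg: "is_alg maj_sig A" using A by (simp add: models_def)
  let ?J = "con_join maj_sig A (\<alpha> \<inter> \<beta>) (\<alpha> \<inter> \<gamma>)"
  show "?J \<subseteq> \<alpha> \<inter> con_join maj_sig A \<beta> \<gamma>"
    using con con_join_upper[of \<beta> \<gamma> maj_sig A]
    by (intro con_join_least Int_Con con_join_in_Con alg) auto
  show "\<alpha> \<inter> con_join maj_sig A \<beta> \<gamma> \<subseteq> ?J"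
  proof (rule subrelI)
    fix x y assume xy: "(x, y) \<in> \<alpha> \<inter> con_join maj_sig A \<beta> \<gamma>"
    then have chain: "(x, y) \<in> (\<beta> \<union> \<gamma>)\<^sup>+" and xy\<alpha>: "(x, y) \<in> \<alpha>"
      using con_join_subset_trancl[OF alg con(2,3)] by blast+
    have carr: "x \<in> carr A" "y \<in> carr A" using xy\<alpha> Con_D(1)[OF con(1)] by blast+
    have J: "?J \<in> Con maj_sig A" by (intro con_join_in_Con Int_Con alg con)
    let ?m = "\<lambda>z. interp A 0 [x, y, z]"
    have link: "(?m z, ?m w) \<in> ?J" if zw: "(z, w) \<in> \<beta> \<union> \<gamma>" for z w
    proof -
      have zw_carr: "z \<in> carr A" "w \<in> carr A"
        using zw Con_D(1)[OF con(2)] Con_D(1)[OF con(3)] by blast+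
      have to_x: "(x, ?m u) \<in> \<alpha>" if "u \<in> carr A" for u
      proof -
        have "(interp A 0 [x, x, u], ?m u) \<in> \<alpha>"
          using that carr xy\<alpha> Con_D(2)[OF con(1)] by (intro maj_Con[OF con(1)])
        then show ?thesis using A carr that by (simp add: maj_models_iff)
      qed
      have "(?m z, ?m w) \<in> \<alpha>" using to_x zw_carr Con_D(3,4)[OF con(1)] by blast
      moreover have "(?m z, ?m w) \<in> \<beta> \<union> \<gamma>"
      proof (cases "(z, w) \<in> \<beta>")
        case True
        then have "(?m z, ?m w) \<in> \<beta>" using carr Con_D(2)[OF con(2)] by (intro maj_Con[OF con(2)])
        then show ?thesis by blast
      next
        case False
        then have "(z, w) \<in> \<gamma>" using zw by blast
        then have "(?m z, ?m w) \<in> \<gamma>" using carr Con_D(2)[OF con(3)] by (intro maj_Con[OF con(3)])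
        then show ?thesis by blast
      qed
      ultimately show ?thesis using con_join_upper[of "\<alpha> \<inter> \<beta>" "\<alpha> \<inter> \<gamma>" maj_sig A] by blast
    qed
    have "(?m x, ?m z) \<in> ?J" if "(x, z) \<in> (\<beta> \<union> \<gamma>)\<^sup>+" for z
      using that
    proof (induction rule: trancl_induct)
      case (base z)
      then show ?case by (rule link)
    next
      case (step z w)
      show ?case by (rule Con_D(4)[OF J step(3) link[OF step(2)]])
    qed
    from this[OF chain] show "(x, y) \<in> ?J" using A carr by (simp add: maj_models_iff)
  qed
qed

text \<open>A subalgebra \<open>{e}\<close> makes both constants equal to \<open>e\<close>, so x =
  m(e, x, e) = e for every x.\<close>

lemma maj_semi_degenerate: "semi_degenerate maj_sig maj_ids"
  unfolding semi_degenerate_def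
proof (intro allI impI notI)
  fix A :: "(nat, (nat, nat) trm) alg"
  assume A: "A \<in> models maj_sig maj_ids" and nt: "nontrivial A" and "\<exists>e. subuniverse maj_sig A {e}"
  then obtain e where e: "e \<in> carr A" "closed_under maj_sig A {e}" by (auto simp: subuniverse_def)
  then have "interp A 1 [] = e" "interp A 2 [] = e"
    by (auto simp: closed_under_def maj_sig_def)
  then have "interp A 0 [e, x, e] = x" "interp A 0 [e, x, e] = e" if "x \<in> carr A" for x
    using A e(1) that unfolding maj_models_iff by metis+
  then have "x = e" if "x \<in> carr A" for x using that by metis
  then show False using nt unfolding nontrivial_def by metis
qed

text \<open>From m(x, x, x) = x = m(x, x, y), centralizing allows the first argument to move to y,
  which relates m(y, x, x) = x to m(y, x, y) = y.\<close>

lemma maj_commutator: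
  assumes A: "A \<in> models maj_sig maj_ids"
    and \<alpha>: "\<alpha> \<in> Con maj_sig A" and \<beta>: "\<beta> \<in> Con maj_sig A"
  shows "\<alpha> \<inter> \<beta> \<subseteq> commutator maj_sig A \<alpha> \<beta>"
proof (rule subrelI)
  fix x y assume xy: "(x, y) \<in> \<alpha> \<inter> \<beta>"
  have alg: "is_alg maj_sig A" using A by (simp add: models_def)
  let ?\<delta> = "commutator maj_sig A \<alpha> \<beta>"
  have carr: "x \<in> carr A" "y \<in> carr A" using xy Con_D(1)[OF \<alpha>] by blast+
  note \<delta> = commutator_least(1,2)[OF alg \<alpha> \<beta>]
  define t :: "(nat, nat + nat) trm" where "t = maj (Var (Inl 0)) (Var (Inr 0)) (Var (Inr 1))"
  let ?c = "\<lambda>_::nat. x" and ?d = "\<lambda>j::nat. if j = 0 then x else y"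
  have m: "interp A 0 [x, x, x] = x" "interp A 0 [x, x, y] = x" "interp A 0 [y, x, x] = x"
      "interp A 0 [y, x, y] = y"
    using A carr by (simp_all add: maj_models_iff)
  have "wf_trm maj_sig t" by (simp add: t_def maj_sig_def)
  moreover have "\<forall>i. (?c i, (\<lambda>_::nat. y) i) \<in> \<alpha>" "\<forall>j. (?c j, ?d j) \<in> \<beta>"
    using xy carr Con_D(2)[OF \<beta>] by auto
  moreover have "(eval A (case_sum ?c ?c) t, eval A (case_sum ?c ?d) t) \<in> ?\<delta>"
    using m carr Con_D(2)[OF \<delta>(1)] by (simp add: t_def)
  ultimately have "(eval A (case_sum (\<lambda>_. y) ?c) t, eval A (case_sum (\<lambda>_. y) ?d) t) \<in> ?\<delta>"
    using \<delta>(2)[unfolded centralizes_def, rule_format, of t ?c "\<lambda>_. y" ?c ?d] by blast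
  then show "(x, y) \<in> ?\<delta>" using m by (simp add: t_def)
qed

text \<open>If the commutator lies below equality then so does the intersection, hence the two
  congruences cannot both be full.\<close>

lemma maj_simple_Spec:
  assumes A: "A \<in> models maj_sig maj_ids" and nt: "nontrivial A"
    and simple: "Con maj_sig A \<subseteq> {Id_on (carr A), nabla A}"
  shows "Spec maj_sig A = {Id_on (carr A)}"
proof -
  have alg: "is_alg maj_sig A" using A by (simp add: models_def)
  have ne: "Id_on (carr A) \<noteq> nabla A" using nt by (auto simp: nontrivial_def nabla_def)
  have Id: "Id_on (carr A) \<in> Con maj_sig A"
  proof (rule Con_I)
    fix f xs ys
    assume f: "maj_sig f = Some (length xs)" and l: "list_all2 (\<lambda>x y. (x, y) \<in> Id_on (carr A)) xs ys"
    then have "xs = ys" "set xs \<subseteq> carr A"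
      by (auto simp: list_all2_conv_all_nth in_set_conv_nth Id_on_iff intro: nth_equalityI)
    then show "(interp A f xs, interp A f ys) \<in> Id_on (carr A)"
      using alg f by (auto simp: is_alg_def closed_under_def)
  qed auto
  have "\<alpha> \<subseteq> Id_on (carr A) \<or> \<beta> \<subseteq> Id_on (carr A)"
    if \<alpha>: "\<alpha> \<in> Con maj_sig A" and \<beta>: "\<beta> \<in> Con maj_sig A"
      and "commutator maj_sig A \<alpha> \<beta> \<subseteq> Id_on (carr A)" for \<alpha> \<beta>
  proof -
    have "\<alpha> \<inter> \<beta> \<subseteq> Id_on (carr A)" using maj_commutator[OF A \<alpha> \<beta>] that(3) by blast
    moreover have "\<not> nabla A \<subseteq> Id_on (carr A)" using nt by (auto simp: nontrivial_def nabla_def)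
    ultimately show ?thesis using simple \<alpha> \<beta> by blast
  qed
  then have "Id_on (carr A) \<in> Spec maj_sig A" using Id ne by (simp add: Spec_def)
  then show ?thesis using simple by (auto simp: Spec_def)
qed

text \<open>A majority operation making the natural numbers simple, with \<open>0\<close> and \<open>1\<close> as constants.\<close>

definition maj3 :: "nat \<Rightarrow> nat \<Rightarrow> nat \<Rightarrow> nat" where
  "maj3 x y z = (if x = y \<or> x = z then x else if y = z then y else if x = 0 then y else z)"

text \<open>The operations do not depend on \<open>S\<close>, so inclusions between these algebras
  are morphisms.\<close>

definition maj_nat :: "nat set \<Rightarrow> (nat, nat) alg" where
  "maj_nat S = \<lparr>carr = S, interp = (\<lambda>f xs.
     if f = 0 then maj3 (xs ! 0) (xs ! 1) (xs ! 2) else if f = 1 then 0 else 1)\<rparr>"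

lemma maj_nat_simps [simp]:
  "carr (maj_nat S) = S" "interp (maj_nat S) 0 [x, y, z] = maj3 x y z"
  "interp (maj_nat S) (Suc 0) [] = 0" "interp (maj_nat S) 2 [] = 1"
  by (simp_all add: maj_nat_def)

text \<open>\<open>maj3\<close> returns one of its arguments, so every set containing both constants
  is closed.\<close>

lemma maj_nat_in_models:
  assumes S: "0 \<in> S" "1 \<in> S" shows "maj_nat S \<in> models maj_sig maj_ids"
proof -
  have "interp (maj_nat S) f xs \<in> S"
    if f: "maj_sig f = Some (length xs)" and xs: "set xs \<subseteq> S" for f xs
  proof (cases "f = 0")
    case True
    then have "length xs = 3" using f by (simp add: maj_sig_def)
    then have "xs ! 0 \<in> S" "xs ! 1 \<in> S" "xs ! 2 \<in> S" using xs by auto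
    then show ?thesis using True by (simp add: maj_nat_def maj3_def)
  qed (use S in \<open>auto simp: maj_nat_def\<close>)
  then have "is_alg maj_sig (maj_nat S)" using S by (auto simp: is_alg_def closed_under_def)
  then show ?thesis by (auto simp: maj_models_iff maj3_def)
qed

text \<open>A pair of distinct elements yields some (0, z) with z nonzero; then m(0, 1, -) yields
  (0, 1), and m(0, u, -) yields (0, u) for every u.\<close>

lemma maj_nat_simple:
  assumes S: "0 \<in> S" "1 \<in> S"
  shows "Con maj_sig (maj_nat S) \<subseteq> {Id_on (carr (maj_nat S)), nabla (maj_nat S)}"
proof
  fix \<theta> assume \<theta>: "\<theta> \<in> Con maj_sig (maj_nat S)"
  note m = maj_Con[OF \<theta>, simplified]
  have refl: "(x, x) \<in> \<theta>" if "x \<in> S" for x using Con_D(2)[OF \<theta>] that by simp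
  have sub: "\<theta> \<subseteq> S \<times> S" using Con_D(1)[OF \<theta>] by simp
  have "\<theta> = nabla (maj_nat S)" if xy: "(x, y) \<in> \<theta>" "x \<noteq> y" for x y
  proof -
    have xyS: "x \<in> S" "y \<in> S" using xy(1) sub by auto
    have "\<exists>z. z \<noteq> 0 \<and> (0, z) \<in> \<theta>"
    proof (cases "x = 0 \<or> y = 0")
      case True
      then show ?thesis using xy Con_D(3)[OF \<theta>] by metis
    next
      case False
      \<comment> \<open>For distinct nonzero \<open>x\<close> and \<open>y\<close> the last branch
        of \<open>maj3\<close> gives 0 on the left, majority gives \<open>x\<close> on the
        right.\<close>
      have "(maj3 x y 0, maj3 x x 0) \<in> \<theta>" using xyS S xy refl Con_D(3)[OF \<theta>] by (intro m) auto
      then show ?thesis using False xy(2) by (auto simp: maj3_def)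
    qed
    then obtain z where z: "z \<noteq> 0" "(0, z) \<in> \<theta>" by blast
    have "(maj3 0 1 0, maj3 0 1 z) \<in> \<theta>" using z S refl by (intro m) auto
    then have 01: "(0, 1) \<in> \<theta>" using z(1) by (auto simp: maj3_def split: if_splits)
    have to0: "(0, u) \<in> \<theta>" if "u \<in> S" for u
    proof -
      have "(maj3 0 u 0, maj3 0 u 1) \<in> \<theta>" using 01 that S refl by (intro m) auto
      then show ?thesis by (auto simp: maj3_def split: if_splits)
    qed
    have "(u, w) \<in> \<theta>" if "u \<in> S" "w \<in> S" for u w
      using to0[OF that(1)] to0[OF that(2)] Con_D(3,4)[OF \<theta>] by blast
    then show ?thesis using sub by (auto simp: nabla_def)
  qed
  then have "\<theta> = nabla (maj_nat S)" if "\<not> \<theta> \<subseteq> Id" using that by auto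
  moreover have "\<theta> = Id_on S" if "\<theta> \<subseteq> Id" using that refl sub by auto
  ultimately show "\<theta> \<in> {Id_on (carr (maj_nat S)), nabla (maj_nat S)}" by auto
qed

lemma maj_nat_Spec:
  assumes S: "0 \<in> S" "1 \<in> S"
  shows "Spec maj_sig (maj_nat S) = {Id_on S}"
proof -
  have "nontrivial (maj_nat S)" using S unfolding nontrivial_def by (metis maj_nat_simps(1) zero_neq_one)
  then show ?thesis
    using maj_simple_Spec[OF maj_nat_in_models[OF S] _ maj_nat_simple[OF S]] by simp
qed

theorem proposition4p12:
  shows "(\<forall>(F :: 'f sig) E (M :: ('f, 'a) alg) (N :: ('f, 'b) alg) h.
            is_identities F E \<longrightarrow> congruence_modular F E \<longrightarrow>
            M \<in> models F E \<longrightarrow> N \<in> models F E \<longrightarrow> morphism F M N h \<longrightarrow>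
            h ` carr M = carr N \<longrightarrow>
            admissible F M N h \<and> GU F M N h \<and> LO F M N h) \<and>
         (\<exists>(F :: nat sig) E.
            is_identities F E \<and> congruence_distributive F E \<and> semi_degenerate F E \<and>
            (\<exists>(M :: (nat, nat) alg) (N :: (nat, nat) alg) h.
               M \<in> models F E \<and> N \<in> models F E \<and> morphism F M N h \<and>
               admissible F M N h \<and> GU F M N h \<and> LO F M N h \<and>
               h ` carr M \<noteq> carr N))"
proof (rule conjI)
  show "\<forall>(F :: 'f sig) E (M :: ('f, 'a) alg) (N :: ('f, 'b) alg) h.
      is_identities F E \<longrightarrow> congruence_modular F E \<longrightarrow>
      M \<in> models F E \<longrightarrow> N \<in> models F E \<longrightarrow> morphism F M N h \<longrightarrow>
      h ` carr M = carr N \<longrightarrow> admissible F M N h \<and> GU F M N h \<and> LO F M N h"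
    by (intro allI impI conjI; (rule surjective_admissible | rule surjective_GU | rule surjective_LO))
      (assumption | simp add: models_def)+
  \<comment> \<open>Inclusion of the two-element algebra into all natural numbers. Both spectra
    consist of equality alone, and equality pulls back to equality, which settles all three
    conditions.\<close>
  let ?M = "maj_nat {0, 1}" and ?N = "maj_nat UNIV" and ?h = "\<lambda>x::nat. x"
  have M: "?M \<in> models maj_sig maj_ids" and N: "?N \<in> models maj_sig maj_ids"
    by (simp_all add: maj_nat_in_models)
  have Spec: "Spec maj_sig ?M = {Id_on {0, 1}}" "Spec maj_sig ?N = {Id}"
    using maj_nat_Spec[of "{0, 1}"] maj_nat_Spec[of UNIV] by auto
  have pb: "pullback ?M ?h Id = Id_on {0, 1}" by (auto simp: pullback_def)
  have "morphism maj_sig ?M ?N ?h" by (auto simp: morphism_def maj_nat_def)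
  moreover have "admissible maj_sig ?M ?N ?h" "GU maj_sig ?M ?N ?h" "LO maj_sig ?M ?N ?h"
    by (simp_all add: admissible_def GU_def LO_def Spec pb del: One_nat_def)
  moreover have "?h ` carr ?M \<noteq> carr ?N" by auto
  ultimately show "\<exists>(F :: nat sig) E.
      is_identities F E \<and> congruence_distributive F E \<and> semi_degenerate F E \<and>
      (\<exists>(M :: (nat, nat) alg) (N :: (nat, nat) alg) h.
         M \<in> models F E \<and> N \<in> models F E \<and> morphism F M N h \<and>
         admissible F M N h \<and> GU F M N h \<and> LO F M N h \<and> h ` carr M \<noteq> carr N)"
    by (intro exI[of _ maj_sig] exI[of _ maj_ids] exI[of _ ?M] exI[of _ ?N] exI[of _ ?h] conjI
        maj_is_identities maj_congruence_distributive maj_semi_degenerate M N)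
qed

end
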